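(* Let $P(X)\in\mathbb Z[X]$ of degree $d$, with roots $\alpha_1,\dots,\alpha_d$ and constant term $a_0$, satisfy the standing assumptions in the context. Assume that $P(X)$ is monic and that $\alpha_j>1$ (in particular $\alpha_j$ is real) for every $1\le j\le d$. Moreover, suppose that $$\alpha_1^{-1}+\alpha_2^{-1}+\cdots+\alpha_d^{-1}\le\frac12 .$$ Then $|a_0|^{-1}E_d(\alpha_1^{-1},\dots,\alpha_d^{-1})$ is the minimal limit point of $\mathcal L(P(X))$. Moreover, $$\mathcal L(P(X))\cap\Bigl(0,\tfrac1{|a_0|}E_d(\alpha_1^{-1},\dots,\alpha_d^{-1})\Bigr)=\Bigl\{\tfrac1{|a_0|}E_d^{(k)}(\alpha_1^{-1},\dots,\alpha_d^{-1}) : k=0,1,\dots\Bigr\}.$$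
   Context: Setting. $P(X)=a_dX^d+\cdots+a_0\in\mathbb Z[X]$ with $d\ge1$, $a_d\ge1$, such that (i) $\gcd(a_d,\dots,a_0)=1$ and $a_0\ne0$; (ii) $P$ has no multiple roots; (iii) every irreducible factor of $P$ in $\mathbb Z[X]$ has at least one root of modulus greater than $1$. The roots of $P$ are $\alpha_1,\dots,\alpha_d$. When all roots of $P$ are real and greater than $1$ (as in the claim), for $\mathbf g=(g_1,\dots,g_d)\in\mathbb R^d$ put $x_n(\mathbf g)=\sum_{i=1}^d g_i\alpha_i^n$; with $\|x\|$ the distance from $x\in\mathbb R$ to the nearest integer, $\mathcal L(P)=\{\limsup_{n\to\infty}\|x_n(\mathbf g)\| : \mathbf g\in\mathbb R^d\}$. A limit point is an accumulation point. Define $$E(X)=\frac{1-(1-X)\prod_{m=0}^\infty(1-X^{2^m})}{2X},\qquad E^{(k)}(X)=\frac{1+X^{2^k}-(1-X)\prod_{m=0}^{k-1}(1-X^{2^m})}{2X(1+X^{2^k})}\quad(k\ge0),$$ with $\prod_{m=0}^{k-1}(1-X^{2^m})=1$ for $k=0$, and for $r\ge1$ $$E_r(X_1,\dots,X_r)=\sum_{i=1}^r\Bigl(\prod_{1\le j\le r,\ j\ne i}\frac{X_i}{X_i-X_j}\Bigr)E(X_i),\qquad E_r^{(k)}(X_1,\dots,X_r)=\sum_{i=1}^r\Bigl(\prod_{1\le j\le r,\ j\ne i}\frac{X_i}{X_i-X_j}\Bigr)E^{(k)}(X_i).$$ *)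

theory Defs
  imports
    "HOL-Analysis.Analysis"
    "HOL-Computational_Algebra.Computational_Algebra"
begin

definition admissible_poly :: "int poly \<Rightarrow> bool" where
  "admissible_poly P \<longleftrightarrow>
     degree P \<ge> 1 \<and> lead_coeff P \<ge> 1 \<and>
     content P = 1 \<and> coeff P 0 \<noteq> 0 \<and>
     rsquarefree (map_poly complex_of_int P) \<and>
     (\<forall>Q. irreducible Q \<and> Q dvd P \<longrightarrow>
        (\<exists>z. poly (map_poly complex_of_int Q) z = 0 \<and> cmod z > 1))"

text \<open>The numbers \<open>\<alpha> 1, \<dots>, \<alpha> (degree P)\<close> are all complex roots of \<open>P\<close>, listed with
  multiplicity. Values of \<open>\<alpha>\<close> at other indices are irrelevant.\<close>

definition lists_roots :: "int poly \<Rightarrow> (nat \<Rightarrow> complex) \<Rightarrow> bool" where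
  "lists_roots P \<alpha> \<longleftrightarrow>
     map_poly complex_of_int P =
       smult (complex_of_int (lead_coeff P)) (\<Prod>i\<in>{1..degree P}. [:- \<alpha> i, 1:])"

definition xseq :: "nat \<Rightarrow> (nat \<Rightarrow> real) \<Rightarrow> (nat \<Rightarrow> real) \<Rightarrow> nat \<Rightarrow> real" where
  "xseq d \<alpha> g n = (\<Sum>i\<in>{1..d}. g i * \<alpha> i ^ n)"

text \<open>A vector in \<open>\<real>\<^sup>d\<close> is a function \<open>g\<close> of which only the values at \<open>1, \<dots>, d\<close> matter.
  The limsup of the distances to the nearest integer is taken in the extended reals; as these
  distances lie in \<open>[0, 1/2]\<close>, it is always finite.\<close>

definition spectrum :: "nat \<Rightarrow> (nat \<Rightarrow> real) \<Rightarrow> real set" where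
  "spectrum d \<alpha> =
     {l. \<exists>g :: nat \<Rightarrow> real. ereal l = limsup (\<lambda>n. ereal (infdist (xseq d \<alpha> g n) \<int>))}"

definition E :: "real \<Rightarrow> real" where
  "E X = (1 - (1 - X) * (\<Prod>m. 1 - X ^ (2 ^ m))) / (2 * X)"

definition E_trunc :: "nat \<Rightarrow> real \<Rightarrow> real" where
  "E_trunc k X =
     (1 + X ^ (2 ^ k) - (1 - X) * (\<Prod>m<k. 1 - X ^ (2 ^ m))) / (2 * X * (1 + X ^ (2 ^ k)))"

text \<open>For a one-variable function \<open>F\<close>, the combination
  \<open>\<Sum>\<^sub>i (\<Prod>\<^sub>j\<^sub>\<noteq>\<^sub>i X\<^sub>i / (X\<^sub>i - X\<^sub>j)) F(X\<^sub>i)\<close>, meaningful when \<open>X\<^sub>1, \<dots>, X\<^sub>r\<close> are distinct.\<close>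

definition interp :: "(real \<Rightarrow> real) \<Rightarrow> nat \<Rightarrow> (nat \<Rightarrow> real) \<Rightarrow> real" where
  "interp F r X = (\<Sum>i\<in>{1..r}. (\<Prod>j\<in>{1..r} - {i}. X i / (X i - X j)) * F (X i))"

definition E_multi :: "nat \<Rightarrow> (nat \<Rightarrow> real) \<Rightarrow> real" where
  "E_multi r X = interp E r X"

definition E_multi_trunc :: "nat \<Rightarrow> nat \<Rightarrow> (nat \<Rightarrow> real) \<Rightarrow> real" where
  "E_multi_trunc k r X = interp (E_trunc k) r X"

end

theory Submission
  imports Defs
begin

text \<open>
  Write \<open>x\<^sub>n = u\<^sub>n + \<epsilon>\<^sub>n\<close> with \<open>u\<^sub>n\<close> a nearest integer. Since \<open>x\<close> satisfies the linear recurrence with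
  coefficients \<open>a\<^sub>j\<close> of \<open>P\<close>, the numbers \<open>s\<^sub>n = \<Sum>\<^sub>j a\<^sub>j \<epsilon>\<^sub>n\<^sub>+\<^sub>j = - \<Sum>\<^sub>j a\<^sub>j u\<^sub>n\<^sub>+\<^sub>j\<close> are bounded
  integers. All roots exceed 1, so the recurrence operator can be inverted on bounded sequences by a
  series that looks into the future: \<open>a\<^sub>0 \<epsilon>\<^sub>n = \<Sum>\<^sub>m h\<^sub>m s\<^sub>n\<^sub>+\<^sub>m\<close>, where \<open>h\<^sub>m\<close> is the complete homogeneous
  symmetric polynomial of degree \<open>m\<close> in the reciprocals of the roots
  (\<open>integer_sequence_of_errors\<close>). Conversely every bounded integer sequence \<open>s\<close> arises
  (\<open>integer_sequence_realized\<close>), because \<open>P\<close> is monic. The question is thus which values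
  \<open>limsup \<bar>\<Sum>\<^sub>m h\<^sub>m s\<^sub>n\<^sub>+\<^sub>m\<bar>\<close> occur for bounded integer sequences \<open>s\<close>.

  The main effect of the hypothesis on the sum of the reciprocals is that \<open>2 h\<^sub>m\<^sub>+\<^sub>1 \<le> h\<^sub>m\<close>, so that
  each weight dominates all later ones together. If the limsup is less than 1, the integers \<open>s\<^sub>n\<close>
  are eventually in \<open>{-1, 0, 1}\<close> and their nonzero values alternate in sign, for
  two equal consecutive signs would already produce a value \<open>\<ge> 1\<close>. Such a sequence is either eventually zero or of the form \<open>s\<^sub>n = (t\<^sub>n - t\<^sub>n\<^sub>+\<^sub>1) / 2\<close> with signs \<open>t\<^sub>n = \<plusminus>1\<close>,
  and then \<open>\<bar>\<Sum>\<^sub>m h\<^sub>m s\<^sub>n\<^sub>+\<^sub>m\<bar>\<close> is a lexicographically decreasing function of the sign sequence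
  \<open>i \<mapsto> t\<^sub>n t\<^sub>n\<^sub>+\<^sub>i\<close> (\<open>code_val_lex\<close>).

  What remains is combinatorics on words. Let \<open>\<tau>\<close> be the Thue-Morse sequence. If \<open>t\<close> is not
  eventually constant and all the sequences \<open>i \<mapsto> t\<^sub>n t\<^sub>n\<^sub>+\<^sub>i\<close> exceed \<open>\<tau>\<close> within a fixed number
  \<open>L\<close> of letters, then \<open>t\<close> is eventually either alternating or the image of a sequence \<open>t'\<close> under the substitution \<open>1 \<mapsto> (1, -1)\<close>,
  \<open>-1 \<mapsto> (-1, 1)\<close>; as \<open>\<tau>\<close> is fixed by this substitution, \<open>t'\<close> inherits the hypothesis with \<open>L\<close>
  halved. Induction on \<open>L\<close> shows that \<open>t\<close> is eventually periodic, equal up to sign to the \<open>k\<close>-fold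
  image \<open>\<tau>\<^sup>(\<^sup>k\<^sup>)\<close> of the alternating sequence (\<open>thue_morse_rigidity\<close>). The generating functions of the
  codes of \<open>\<tau>\<close> and of \<open>\<tau>\<^sup>(\<^sup>k\<^sup>)\<close> are \<open>E\<close> and \<open>E_trunc k\<close>, and replacing the power \<open>X\<^sup>m\<close> by \<open>h\<^sub>m\<close> is
  exactly what \<open>interp\<close> does. So the positive values below the Thue-Morse value are those of the \<open>\<tau>\<^sup>(\<^sup>k\<^sup>)\<close>;
  they approach it strictly from below, because \<open>\<tau>\<^sup>(\<^sup>k\<^sup>)\<close> and \<open>\<tau>\<close> first differ at position \<open>2\<^sup>k\<^sup>+\<^sup>1\<close>,
  where \<open>\<tau>\<^sup>(\<^sup>k\<^sup>)\<close> is the larger one and therefore has the smaller value.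
\<close>

section \<open>Sign sequences above the Thue-Morse sequence\<close>

definition sign_seq :: "(nat \<Rightarrow> real) \<Rightarrow> bool" where
  "sign_seq t \<longleftrightarrow> (\<forall>n. t n = 1 \<or> t n = -1)"

text \<open>The substitution that replaces the letter \<open>1\<close> by \<open>1, -1\<close> and the letter \<open>-1\<close> by \<open>-1, 1\<close>.\<close>

definition doubling :: "(nat \<Rightarrow> real) \<Rightarrow> nat \<Rightarrow> real" where
  "doubling t n = (-1) ^ n * t (n div 2)"

fun thue_morse :: "nat \<Rightarrow> real" where
  "thue_morse n = (if n = 0 then 1 else (-1) ^ n * thue_morse (n div 2))"

declare thue_morse.simps [simp del]

text \<open>The Thue-Morse word of length \<open>2\<^sup>k\<close> followed by its negative, repeated for ever.\<close>

primrec periodic_tm :: "nat \<Rightarrow> nat \<Rightarrow> real" where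
  "periodic_tm 0 = (\<lambda>n. (-1) ^ n)"
| "periodic_tm (Suc k) = doubling (periodic_tm k)"

text \<open>The sequence from position \<open>n\<close> on, normalised by a global sign so as to start with \<open>1\<close>.\<close>

definition signed_tail :: "(nat \<Rightarrow> real) \<Rightarrow> nat \<Rightarrow> nat \<Rightarrow> real" where
  "signed_tail t n i = t n * t (n + i)"

text \<open>Bounding the position of the first difference by \<open>L\<close> turns a strict lexicographic inequality into
  a uniform one, and makes it a quantity on which one can do induction.\<close>

definition lex_less_within :: "nat \<Rightarrow> (nat \<Rightarrow> real) \<Rightarrow> (nat \<Rightarrow> real) \<Rightarrow> bool" where
  "lex_less_within L t u \<longleftrightarrow> (\<exists>j\<le>L. (\<forall>i<j. t i = u i) \<and> t j < u j)"

lemma sign_seqD: "sign_seq t \<Longrightarrow> t n = 1 \<or> t n = -1"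
  by (simp add: sign_seq_def)

lemma doubling_even [simp]: "doubling t (2 * m) = t m"
  and doubling_odd [simp]: "doubling t (Suc (2 * m)) = - t m"
  by (simp_all add: doubling_def)

lemma thue_morse_0 [simp]: "thue_morse 0 = 1"
  by (simp add: thue_morse.simps)

lemma doubling_thue_morse [simp]: "doubling thue_morse = thue_morse"
proof
  fix n show "doubling thue_morse n = thue_morse n"
    by (cases "n = 0") (simp_all add: doubling_def thue_morse.simps [of n])
qed

lemma thue_morse_even [simp]: "thue_morse (2 * m) = thue_morse m"
  and thue_morse_odd [simp]: "thue_morse (Suc (2 * m)) = - thue_morse m"
  using doubling_even [of thue_morse m] doubling_odd [of thue_morse m] by simp_all

lemma sign_seq_doubling: "sign_seq t \<Longrightarrow> sign_seq (doubling t)"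
  unfolding sign_seq_def doubling_def
  by (metis minus_one_power_iff mult_minus1 mult_1 minus_minus)

lemma sign_seq_thue_morse: "sign_seq thue_morse"
  unfolding sign_seq_def
proof
  fix n show "thue_morse n = 1 \<or> thue_morse n = -1"
  proof (induction n rule: less_induct)
    case (less n)
    show ?case
    proof (cases "n = 0")
      case False
      then have "thue_morse (n div 2) = 1 \<or> thue_morse (n div 2) = -1"
        by (intro less) simp
      then show ?thesis
        using False by (auto simp: thue_morse.simps [of n] minus_one_power_iff)
    qed simp
  qed
qed

lemma sign_seq_periodic_tm: "sign_seq (periodic_tm k)"
proof (induction k)
  case 0 show ?case by (simp add: sign_seq_def minus_one_power_iff)
qed (simp add: sign_seq_doubling)

lemma sign_seq_signed_tail: "sign_seq t \<Longrightarrow> sign_seq (signed_tail t n)"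
  unfolding sign_seq_def signed_tail_def by (metis mult_minus1 mult_1 minus_minus)

lemma signed_tail_0: "sign_seq t \<Longrightarrow> signed_tail t n 0 = 1"
  using sign_seqD [of t n] by (auto simp: signed_tail_def)

lemma thue_morse_initial:
  "thue_morse (Suc 0) = -1" "thue_morse 2 = -1" "thue_morse 3 = 1"
  "thue_morse 4 = -1" "thue_morse 5 = 1" "thue_morse 6 = 1"
proof -
  show 1: "thue_morse (Suc 0) = -1" using thue_morse_odd [of 0] by simp
  show 2: "thue_morse 2 = -1" using thue_morse_even [of 1] 1 by simp
  show 3: "thue_morse 3 = 1" using thue_morse_odd [of 1] 1 by (simp add: numeral_3_eq_3)
  show "thue_morse 4 = -1" using thue_morse_even [of 2] 2 by simp
  show "thue_morse 5 = 1" using thue_morse_odd [of 2] 2 by simp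
  show "thue_morse 6 = 1" using thue_morse_even [of 3] 3 by simp
qed

lemma thue_morse_power2 [simp]: "thue_morse (2 ^ k) = -1"
  by (induction k) (simp_all add: thue_morse_initial)

lemma periodic_tm_0 [simp]: "periodic_tm k 0 = 1"
  by (induction k) (simp_all add: doubling_def)

lemma periodic_tm_1 [simp]: "periodic_tm k (Suc 0) = -1"
  by (induction k) (simp_all add: doubling_def)

lemma periodic_tm_period: "periodic_tm k (n + 2 ^ Suc k * q) = periodic_tm k n"
proof (induction k arbitrary: n q)
  case 0 show ?case by (simp add: power_add)
next
  case (Suc k)
  have "n + 2 ^ Suc (Suc k) * q = n + (2 ^ Suc k * q) * 2" by simp
  moreover have "(n + (2 ^ Suc k * q) * 2) div 2 = n div 2 + 2 ^ Suc k * q"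
    by simp
  ultimately show ?case
    using Suc.IH [of "n div 2" q] by (simp only: periodic_tm.simps doubling_def) (simp add: power_add)
qed

lemma periodic_tm_eq_thue_morse: "n < 2 ^ Suc k \<Longrightarrow> periodic_tm k n = thue_morse n"
proof (induction k arbitrary: n)
  case 0
  then have "n = 0 \<or> n = 1" by auto
  then show ?case by (auto simp: thue_morse_initial)
next
  case (Suc k)
  then have "n div 2 < 2 ^ Suc k" by auto
  from Suc.IH [OF this] show ?case
    by (subst doubling_thue_morse [symmetric]) (simp only: periodic_tm.simps doubling_def)
qed

text \<open>By induction along the substitution: tails at even positions are images of tails of the preceding
  sequence, and tails at odd positions exceed the whole sequence within the first two letters after
  the leading one.\<close>

lemma periodic_tm_lex_minimal:
  "signed_tail (periodic_tm k) n = periodic_tm k \<or>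
   (\<exists>L. lex_less_within L (periodic_tm k) (signed_tail (periodic_tm k) n))"
proof (induction k arbitrary: n)
  case 0
  have "signed_tail (periodic_tm 0) n = periodic_tm 0"
    by (rule ext) (simp add: signed_tail_def power_add flip: power_mult_distrib)
  then show ?case ..
next
  case (Suc k)
  let ?t = "periodic_tm k"
  show ?case
  proof (cases "even n")
    case True
    then obtain m where n: "n = 2 * m" by (elim evenE)
    have tail: "signed_tail (doubling ?t) n = doubling (signed_tail ?t m)"
      by (rule ext) (simp add: n signed_tail_def doubling_def power_add)
    from Suc.IH [of m] show ?thesis
    proof
      assume "signed_tail ?t m = ?t"
      with tail show ?thesis by simp
    next
      assume "\<exists>L. lex_less_within L ?t (signed_tail ?t m)"
      then obtain j where j: "\<And>i. i < j \<Longrightarrow> ?t i = signed_tail ?t m i" "?t j < signed_tail ?t m j"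
        by (auto simp: lex_less_within_def)
      have "lex_less_within (2 * j) (doubling ?t) (doubling (signed_tail ?t m))"
        unfolding lex_less_within_def
      proof (intro exI [of _ "2 * j"] conjI allI impI)
        fix i assume "i < 2 * j"
        then have "i div 2 < j" by auto
        then show "doubling ?t i = doubling (signed_tail ?t m) i" by (simp add: doubling_def j)
      qed (simp_all add: j)
      then show ?thesis using tail by auto
    qed
  next
    case False
    then obtain m where n: "n = Suc (2 * m)" by (auto elim: oddE)
    let ?u = "signed_tail (doubling ?t) n"
    have pm: "sign_seq ?t" by (rule sign_seq_periodic_tm)
    have d: "doubling ?t 0 = 1" "doubling ?t (Suc 0) = -1" "doubling ?t 2 = -1"
      by (simp_all add: doubling_def)
    have u: "?u 0 = 1" "?u (Suc 0) = - (?t m * ?t (Suc m))" "?u 2 = ?t m * ?t (Suc m)"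
      using sign_seqD [OF pm, of m]
      by (auto simp: signed_tail_def n doubling_def)
    have "?t m * ?t (Suc m) = 1 \<or> ?t m * ?t (Suc m) = -1"
      using sign_seqD [OF pm, of m] sign_seqD [OF pm, of "Suc m"] by auto
    then have "lex_less_within 2 (doubling ?t) ?u"
    proof
      assume "?t m * ?t (Suc m) = 1"
      then show ?thesis unfolding lex_less_within_def using d u
        by (intro exI [of _ 2]) (auto simp: less_2_cases_iff)
    next
      assume "?t m * ?t (Suc m) = -1"
      then show ?thesis unfolding lex_less_within_def using d u
        by (intro exI [of _ 1]) auto
    qed
    then show ?thesis by auto
  qed
qed

text \<open>The only information about the Thue-Morse sequence that forces the block structure: its first seven
  letters, which forbid certain short patterns in a sequence that lies above it.\<close>

lemma lex_less_thue_morse_forbids: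
  assumes "sign_seq u" "lex_less_within L thue_morse u"
    and "u 1 = -1" "u 2 = -1"
  shows "u 3 = 1" and "u 4 = -1 \<Longrightarrow> u 5 = 1 \<and> u 6 = 1"
proof -
  obtain j where j: "\<And>i. i < j \<Longrightarrow> thue_morse i = u i" "thue_morse j < u j"
    using assms(2) by (auto simp: lex_less_within_def)
  have j0: "j \<noteq> 0" using j(2) sign_seqD [OF assms(1), of 0] by (intro notI) auto
  have j1: "j \<noteq> 1" "j \<noteq> 2" using j(2) assms(3,4) by (auto simp: thue_morse_initial)
  have j3: "j \<noteq> 3" using j(2) sign_seqD [OF assms(1), of 3] by (auto simp: thue_morse_initial)
  have "3 < j" using j0 j1 j3 by linarith
  then show u3: "u 3 = 1" using j(1) [of 3] by (simp add: thue_morse_initial)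
  assume u4: "u 4 = -1"
  have "j \<noteq> 4" "j \<noteq> 5" "j \<noteq> 6"
    using j(2) u4 sign_seqD [OF assms(1), of 5] sign_seqD [OF assms(1), of 6]
    by (auto simp: thue_morse_initial)
  then have "6 < j" using \<open>3 < j\<close> by linarith
  then show "u 5 = 1 \<and> u 6 = 1"
    using j(1) [of 5] j(1) [of 6] by (simp add: thue_morse_initial)
qed

text \<open>Suppose that a letter is followed by two copies of its negative, \<open>b, -b, -b\<close>. The forbidden
  patterns force the next letter to be \<open>b\<close>, and then either the negated configuration reappears two
  places later, or the word continues with \<open>-b, b, b\<close> and it reappears four places later. In both
  cases the intermediate letters pair up as \<open>b, -b\<close> or \<open>-b, b\<close>, so this pairing goes on for ever.\<close>

lemma eventually_doubled:
  assumes pm: "sign_seq t"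
    and lex: "\<And>n. lex_less_within L thue_morse (signed_tail t n)"
    and n: "t (n + 1) = - t n" "t (n + 2) = - t n"
  shows "t (n + 2 * k + 1) = - t (n + 2 * k)"
  using n
proof (induction k arbitrary: n rule: less_induct)
  case (less k)
  note forbid = lex_less_thue_morse_forbids [OF sign_seq_signed_tail [OF pm] lex, of n]
  have sq: "t n * t n = 1" and nz: "t n \<noteq> 0" using sign_seqD [OF pm, of n] by auto
  have u: "signed_tail t n 1 = -1" "signed_tail t n 2 = -1"
    using less.prems sq by (auto simp: signed_tail_def)
  have prod1: "t n * x = 1 \<Longrightarrow> x = t n" for x
    using sign_seqD [OF pm, of n] by auto
  have t3: "t (n + 3) = t n"
    using forbid(1) [OF u] by (intro prod1) (simp add: signed_tail_def)
  consider "k = 0" | "k = 1" | "k \<ge> 2" by linarith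
  then show ?case
  proof cases
    case 1
    then show ?thesis using less.prems by simp
  next
    case 2
    then show ?thesis using t3 less.prems by (simp add: numeral_3_eq_3)
  next
    case 3
    show ?thesis
    proof (cases "t (n + 4) = t n")
      case True
      have "t (n + 2 + 2 * (k - 1) + 1) = - t (n + 2 + 2 * (k - 1))"
        using 3 True t3 less.prems by (intro less.IH) (auto simp: eval_nat_numeral)
      moreover have "n + 2 + 2 * (k - 1) = n + 2 * k" using 3 by simp
      ultimately show ?thesis by (simp only:)
    next
      case False
      then have t4: "t (n + 4) = - t n"
        using sign_seqD [OF pm, of n] sign_seqD [OF pm, of "n + 4"] by auto
      then have "signed_tail t n 4 = -1" using sq by (simp add: signed_tail_def)
      from forbid(2) [OF u this] have t56: "t (n + 5) = t n" "t (n + 6) = t n"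
        by (auto intro!: prod1 simp: signed_tail_def)
      have e: "n + 4 + 1 = n + 5" "n + 4 + 2 = n + 6" by simp_all
      have "t (n + 4 + 1) = - t (n + 4)" "t (n + 4 + 2) = - t (n + 4)"
        by (simp_all only: e t4 t56 minus_minus)
      then have "t (n + 4 + 2 * (k - 2) + 1) = - t (n + 4 + 2 * (k - 2))"
        using 3 by (intro less.IH) simp_all
      moreover have "n + 4 + 2 * (k - 2) = n + 2 * k" using 3 by simp
      ultimately show ?thesis by simp
    qed
  qed
qed

text \<open>The letters of an image at odd positions are determined by those at even positions, so two images
  first differ at an even position.\<close>

lemma lex_less_doubling:
  assumes "lex_less_within L (doubling t) (doubling u)"
  shows "lex_less_within (L div 2) t u"
proof -
  obtain j where j: "j \<le> L" "\<And>i. i < j \<Longrightarrow> doubling t i = doubling u i"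
    "doubling t j < doubling u j"
    using assms by (auto simp: lex_less_within_def)
  have "even j"
  proof (rule ccontr)
    assume "odd j"
    then obtain m where m: "j = Suc (2 * m)" by (auto elim: oddE)
    have "t m = u m" using j(2) [of "2 * m"] m by simp
    then show False using j(3) m by simp
  qed
  then obtain m where m: "j = 2 * m" by (elim evenE)
  have "t i = u i" if "i < m" for i using j(2) [of "2 * i"] that m by simp
  then show ?thesis
    unfolding lex_less_within_def using j m by (intro exI [of _ m]) auto
qed

text \<open>Renormalisation: a sequence that is neither eventually constant nor eventually alternating contains somewhere \<open>b, -b, -b\<close>, hence
  is from there on an image under the substitution of a sequence to which the theorem applies with \<open>L\<close>
  halved. The induction needs no base case, since the hypothesis cannot hold with \<open>L = 0\<close>: all
  sequences involved start with \<open>1\<close>.\<close>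

theorem thue_morse_rigidity:
  assumes "sign_seq t" "\<And>n. lex_less_within L thue_morse (signed_tail t n)"
    and "\<And>N. \<exists>n\<ge>N. t (Suc n) \<noteq> t n"
  shows "\<exists>k M. \<forall>n. t (M + n) = t M * periodic_tm k n"
  using assms
proof (induction L arbitrary: t rule: less_induct)
  case (less L)
  note pm = less.prems(1) and lex = less.prems(2) and change = less.prems(3)
  have flip: "t m = - t n \<longleftrightarrow> t m \<noteq> t n" for m n
    using sign_seqD [OF pm, of n] sign_seqD [OF pm, of m] by auto
  show ?case
  proof (cases "\<exists>M. \<forall>n\<ge>M. t (Suc n) = - t n")
    case True
    then obtain M where M: "\<And>n. n \<ge> M \<Longrightarrow> t (Suc n) = - t n" by blast
    have "t (M + n) = t M * periodic_tm 0 n" for n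
      by (induction n) (simp_all add: M)
    then show ?thesis by blast
  next
    case False
    obtain m where m: "t (Suc m) \<noteq> t m" using change by blast
    \<comment> \<open>The first repeated letter after a change of letter: \<open>t\<close> reads \<open>b, -b, -b\<close> at \<open>p - 1\<close>.\<close>
    define p where "p = (LEAST p. p \<ge> m \<and> t (Suc p) = t p)"
    have "\<exists>p. p \<ge> m \<and> t (Suc p) = t p"
      using False flip by meson
    then have p: "p \<ge> m" "t (Suc p) = t p"
      unfolding p_def by (metis (mono_tags, lifting) LeastI)+
    have pm': "p \<noteq> m" using p m by auto
    define n where "n = p - 1"
    have n: "p = Suc n" "n \<ge> m" using p(1) pm' by (auto simp: n_def)
    have tn: "t (Suc n) \<noteq> t n"
      using not_less_Least [of n "\<lambda>p. p \<ge> m \<and> t (Suc p) = t p"] n by (auto simp: p_def [symmetric])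
    have step: "t (n + 2 * k + 1) = - t (n + 2 * k)" for k
      using tn p(2) n flip by (intro eventually_doubled [OF pm lex]) auto
    define t' where "t' k = t (n + 2 * k)" for k
    have t: "t (n + i) = doubling t' i" for i
    proof (cases "even i")
      case True then show ?thesis by (auto simp: t'_def elim!: evenE)
    next
      case False
      then obtain k where "i = Suc (2 * k)" by (auto elim: oddE)
      then show ?thesis using step [of k] by (simp add: t'_def)
    qed
    have pm'': "sign_seq t'" using pm by (simp add: sign_seq_def t'_def)
    have tail: "signed_tail t (n + 2 * k) = doubling (signed_tail t' k)" for k
      by (rule ext) (simp add: signed_tail_def add.assoc t doubling_def power_add)
    have lex': "lex_less_within (L div 2) thue_morse (signed_tail t' k)" for k
    proof (rule lex_less_doubling)
      show "lex_less_within L (doubling thue_morse) (doubling (signed_tail t' k))"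
        using lex [of "n + 2 * k"] by (simp add: tail)
    qed
    have "L \<noteq> 0"
      using lex [of 0] by (intro notI) (auto simp: lex_less_within_def signed_tail_0 [OF pm])
    then have smaller: "L div 2 < L" by simp
    \<comment> \<open>The image of an eventually constant sequence is eventually alternating.\<close>
    have change': "\<exists>k\<ge>N. t' (Suc k) \<noteq> t' k" for N
    proof (rule ccontr)
      assume "\<not> ?thesis"
      then have const: "\<And>k. k \<ge> N \<Longrightarrow> t' (Suc k) = t' k" by blast
      have "t (Suc j) = - t j" if "j \<ge> n + 2 * N" for j
      proof -
        obtain i where i: "j = n + i" "i \<ge> 2 * N"
          using \<open>j \<ge> n + 2 * N\<close> by (metis add.assoc le_add1 le_iff_add)
        show ?thesis
        proof (cases "even i")
          case True
          then obtain k where "i = 2 * k" by (elim evenE)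
          then show ?thesis using t [of i] t [of "Suc i"] by (simp add: i)
        next
          case False
          then obtain k where k: "i = Suc (2 * k)" by (auto elim: oddE)
          then have "k \<ge> N" using i by simp
          have "doubling t' (Suc i) = t' (Suc k)"
            using doubling_even [of t' "Suc k"] k by simp
          then show ?thesis
            using t [of i] t [of "Suc i"] const [OF \<open>k \<ge> N\<close>] k by (simp add: i)
        qed
      qed
      then show False using False by blast
    qed
    obtain k M where kM: "\<And>i. t' (M + i) = t' M * periodic_tm k i"
      using less.IH [OF smaller pm'' lex' change'] by blast
    have "t (n + 2 * M + i) = t (n + 2 * M) * periodic_tm (Suc k) i" for i
    proof -
      have "t (n + 2 * M + i) = doubling t' (2 * M + i)" by (simp add: add.assoc t)
      also have "\<dots> = (-1) ^ i * t' (M + i div 2)" by (simp add: doubling_def power_add)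
      also have "\<dots> = t' M * periodic_tm (Suc k) i" by (simp add: kM doubling_def)
      finally show ?thesis by (simp add: t'_def)
    qed
    then show ?thesis by blast
  qed
qed

section \<open>Lexicographic order and weighted sums\<close>

text \<open>Weights that decrease so fast that weighted sums of sign sequences are governed by lexicographic
  order. Equality \<open>2 h\<^sub>m\<^sub>+\<^sub>1 = h\<^sub>m\<close> is allowed, as it occurs for the polynomial \<open>X - 2\<close>.\<close>

locale halving_weights =
  fixes h :: "nat \<Rightarrow> real"
  assumes h_0 [simp]: "h 0 = 1"
    and h_pos: "h m > 0"
    and h_half: "2 * h (Suc m) \<le> h m"
begin

text \<open>The weights that appear after summation by parts; they telescope to \<open>h\<close>.\<close>

definition w :: "nat \<Rightarrow> real" where "w m = h m - h (Suc m)"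

definition weighted_tail :: "(nat \<Rightarrow> real) \<Rightarrow> nat \<Rightarrow> real" where
  "weighted_tail s n = (\<Sum>m. h m * s (n + m))"

definition code_val :: "(nat \<Rightarrow> real) \<Rightarrow> real" where
  "code_val t = (\<Sum>m. h m * ((t m - t (Suc m)) / 2))"

lemma h_le_power: "h m \<le> (1 / 2) ^ m"
proof (induction m)
  case (Suc m)
  then show ?case using h_half [of m] by simp
qed simp

lemma h_tendsto_0: "h \<longlonglongrightarrow> 0"
proof (rule tendsto_sandwich [OF _ _ tendsto_const])
  show "(\<lambda>m. (1 / 2 :: real) ^ m) \<longlonglongrightarrow> 0" by (rule LIMSEQ_power_zero) simp
qed (simp_all add: h_le_power less_imp_le [OF h_pos])

lemma summable_h: "summable h"
  by (rule summable_comparison_test' [OF summable_geometric [of "1 / 2 :: real"], of 0])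
    (simp_all add: h_le_power less_imp_le [OF h_pos])

lemma summable_bounded:
  assumes "\<And>m. \<bar>s m\<bar> \<le> B"
  shows "summable (\<lambda>m. h m * s m)"
  by (rule summable_comparison_test' [OF summable_mult [OF summable_h, of B], of 0])
    (simp add: abs_mult less_imp_le [OF h_pos] assms mult_mono mult.commute [of B])

lemma w_ge: "h (Suc m) \<le> w m"
  using h_half [of m] by (simp add: w_def)

lemma w_pos: "w m > 0"
  using w_ge [of m] h_pos [of "Suc m"] by simp

text \<open>Together with \<open>w_ge\<close> this says that the tail after a weight is at most that weight, which is what
  makes the lexicographic comparison work.\<close>

lemma w_sums: "(\<lambda>m. w (m + j)) sums h j"
  using telescope_sums' [of "\<lambda>m. h (m + j)" 0] LIMSEQ_ignore_initial_segment [OF h_tendsto_0, of j]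
  by (simp add: w_def)

lemma summable_w: "summable w"
  using w_sums [of 0] by (simp add: sums_iff)

lemma summable_w_bounded:
  assumes "\<And>m. \<bar>s m\<bar> \<le> B"
  shows "summable (\<lambda>m. w m * s m)"
  by (rule summable_comparison_test' [OF summable_mult [OF summable_w, of B], of 0])
    (simp add: abs_mult less_imp_le [OF w_pos] assms mult_mono mult.commute [of B])

lemma tail_le: "(\<Sum>m. h (m + Suc j)) \<le> h j"
proof -
  have "(\<Sum>m. h (m + Suc j)) \<le> (\<Sum>m. w (m + j))"
    using w_sums [of j] summable_ignore_initial_segment [OF summable_h, of "Suc j"]
    by (intro suminf_le) (auto simp: w_ge sums_iff)
  then show ?thesis using w_sums [of j] by (simp add: sums_iff)
qed

lemma sign_seq_abs: "sign_seq t \<Longrightarrow> \<bar>t n\<bar> \<le> 1"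
  using sign_seqD [of t n] by auto

text \<open>Summation by parts.\<close>

lemma code_val_eq:
  assumes "sign_seq t"
  shows "code_val t = (t 0 - (\<Sum>m. w m * t (Suc m))) / 2"
proof -
  note b = sign_seq_abs [OF assms]
  have s1: "summable (\<lambda>m. h m * t m)" and s2: "summable (\<lambda>m. h m * t (Suc m))"
    by (rule summable_bounded, rule b)+
  have s3: "summable (\<lambda>m. h (Suc m) * t (Suc m))"
    using s1 by (subst summable_Suc_iff [where f = "\<lambda>m. h m * t m"])
  have "code_val t = (\<Sum>m. (h m * t m - h m * t (Suc m)) / 2)"
    by (simp add: code_val_def right_diff_distrib)
  also have "\<dots> = ((\<Sum>m. h m * t m) - (\<Sum>m. h m * t (Suc m))) / 2"
    using s1 s2 by (simp add: suminf_divide suminf_diff summable_diff)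
  also have "(\<Sum>m. h m * t m) = t 0 + (\<Sum>m. h (Suc m) * t (Suc m))"
    using suminf_split_head [OF s1] by simp
  also have "t 0 + (\<Sum>m. h (Suc m) * t (Suc m)) - (\<Sum>m. h m * t (Suc m))
      = t 0 - (\<Sum>m. h m * t (Suc m) - h (Suc m) * t (Suc m))"
    using suminf_diff [OF s2 s3] by simp
  finally show ?thesis by (simp add: w_def left_diff_distrib)
qed

lemma code_val_scale: "sign_seq t \<Longrightarrow> code_val (\<lambda>i. c * t i) = c * code_val t"
proof -
  assume t: "sign_seq t"
  have "\<bar>(t m - t (Suc m)) / 2\<bar> \<le> 1" for m
    using sign_seqD [OF t, of m] sign_seqD [OF t, of "Suc m"] by auto
  then have "summable (\<lambda>m. h m * ((t m - t (Suc m)) / 2))" by (rule summable_bounded)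
  from suminf_mult [OF this, of c] show ?thesis
    by (simp add: code_val_def algebra_simps)
qed

lemma code_val_diff:
  assumes "sign_seq t" "sign_seq u" "\<And>i. i \<le> p \<Longrightarrow> t i = u i"
  shows "code_val t - code_val u = (\<Sum>m. w (m + p) * (u (Suc (m + p)) - t (Suc (m + p)))) / 2"
proof -
  have s: "summable (\<lambda>m. w m * t (Suc m))" "summable (\<lambda>m. w m * u (Suc m))"
    by (rule summable_w_bounded, rule sign_seq_abs, rule assms)+
  have "code_val t - code_val u = (\<Sum>m. w m * u (Suc m) - w m * t (Suc m)) / 2"
    using assms(3) [of 0] suminf_diff [OF s(2) s(1)]
    by (simp add: code_val_eq assms(1,2) diff_divide_distrib)
  also have "(\<Sum>m. w m * u (Suc m) - w m * t (Suc m)) =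
      (\<Sum>m. w (m + p) * (u (Suc (m + p)) - t (Suc (m + p)))) +
      (\<Sum>m<p. w m * u (Suc m) - w m * t (Suc m))"
    using suminf_split_initial_segment [OF summable_diff [OF s(2) s(1)], of p]
    by (simp add: right_diff_distrib)
  also have "(\<Sum>m<p. w m * u (Suc m) - w m * t (Suc m)) = 0"
    by (intro sum.neutral) (simp add: assms(3))
  finally show ?thesis by simp
qed

lemma code_val_close:
  assumes "sign_seq t" "sign_seq u" "\<And>i. i \<le> p \<Longrightarrow> t i = u i"
  shows "\<bar>code_val t - code_val u\<bar> \<le> h p"
proof -
  let ?d = "\<lambda>m. w (m + p) * (u (Suc (m + p)) - t (Suc (m + p)))"
  have b: "\<bar>?d m\<bar> \<le> 2 * w (m + p)" for m
    using sign_seqD [OF assms(1), of "Suc (m + p)"] sign_seqD [OF assms(2), of "Suc (m + p)"]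
      w_pos [of "m + p"] by (auto simp: abs_mult)
  have s: "(\<lambda>m. 2 * w (m + p)) sums (2 * h p)"
    by (intro sums_mult w_sums)
  have sd: "summable (\<lambda>m. \<bar>?d m\<bar>)"
    by (rule summable_comparison_test' [of "\<lambda>m. 2 * w (m + p)" 0])
      (use s b in \<open>auto simp: sums_iff\<close>)
  have "\<bar>\<Sum>m. ?d m\<bar> \<le> (\<Sum>m. \<bar>?d m\<bar>)" by (rule summable_rabs [OF sd])
  also have "\<dots> \<le> 2 * h p"
    using suminf_le [OF b sd] s by (auto simp: sums_iff)
  finally show ?thesis by (simp add: code_val_diff [OF assms])
qed

text \<open>At the first difference the weight \<open>w\<close> counts fully, and it is at least the sum of all later ones.
  Equality would require the largest possible loss at every later place, which is excluded as soon as
  \<open>u\<close> takes the value \<open>1\<close> once more.\<close>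

lemma code_val_lex:
  assumes t: "sign_seq t" and u: "sign_seq u" and "t 0 = u 0"
    and j: "\<And>i. i < j \<Longrightarrow> t i = u i" "t j < u j"
  shows "code_val u \<le> code_val t"
    and "(\<exists>i>j. u i = 1) \<Longrightarrow> code_val u < code_val t"
proof -
  have "j \<noteq> 0" using assms(3) j(2) by (metis less_irrefl)
  then obtain p where p: "j = Suc p" by (metis not0_implies_Suc)
  let ?d = "\<lambda>m. w (m + p) * (u (Suc (m + p)) - t (Suc (m + p)))"
  \<comment> \<open>The excess over the worst case \<open>u = -1\<close>, \<open>t = 1\<close> at all places after \<open>j\<close>.\<close>
  let ?e = "\<lambda>m. w (m + Suc p) * (u (Suc (m + Suc p)) - t (Suc (m + Suc p)) + 2)"
  have tj: "t j = -1" "u j = 1" using j(2) sign_seqD [OF t, of j] sign_seqD [OF u, of j] by auto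
  have b: "0 \<le> u i - t i + 2" "u i - t i + 2 \<le> 4" "u i = 1 \<Longrightarrow> 0 < u i - t i + 2"
    and b2: "\<bar>u i - t i\<bar> \<le> 2" for i
    using sign_seqD [OF t, of i] sign_seqD [OF u, of i] by auto
  have sd: "summable ?d"
    using summable_w_bounded [of "\<lambda>m. u (Suc m) - t (Suc m)", OF b2]
    by (rule summable_ignore_initial_segment)
  have se: "summable ?e"
    using summable_w_bounded [of "\<lambda>m. u (Suc m) - t (Suc m) + 2" 4] b
    by (intro summable_ignore_initial_segment) auto
  have "(\<Sum>m. ?d m) = ?d 0 + (\<Sum>m. ?d (Suc m))"
    using suminf_split_head [OF sd] by simp
  also have "?d 0 = 2 * w p" using tj p by simp
  also have "(\<Sum>m. ?d (Suc m)) = (\<Sum>m. ?e m - 2 * w (m + Suc p))"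
    by (simp add: algebra_simps)
  also have "\<dots> = (\<Sum>m. ?e m) - 2 * h (Suc p)"
    using suminf_diff [OF se, of "\<lambda>m. 2 * w (m + Suc p)"] sums_mult [OF w_sums [of "Suc p"], of 2]
    by (simp add: sums_iff)
  finally have "code_val t - code_val u = w p - h (Suc p) + (\<Sum>m. ?e m) / 2"
    using code_val_diff [OF t u, of p] j(1) p by (simp add: field_simps)
  then have diff: "code_val t - code_val u \<ge> (\<Sum>m. ?e m) / 2"
    using w_ge [of p] by simp
  have e0: "0 \<le> ?e m" for m using b(1) w_pos [of "m + Suc p"] by simp
  have "0 \<le> (\<Sum>m. ?e m)" using e0 by (intro suminf_nonneg se)
  then show "code_val u \<le> code_val t" using diff by linarith
  assume "\<exists>i>j. u i = 1"
  then obtain i where i: "i > Suc p" "u i = 1" using p by auto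
  define m where "m = i - Suc (Suc p)"
  have m: "Suc (m + Suc p) = i" using i by (simp add: m_def)
  have "0 < ?e m" unfolding m using b(3) [OF i(2)] w_pos [of "m + Suc p"] by simp
  then have "0 < (\<Sum>m. ?e m)" using e0 by (intro suminf_pos2 [OF se])
  then show "code_val u < code_val t" using diff by linarith
qed

lemma code_val_lex_within:
  "sign_seq t \<Longrightarrow> sign_seq u \<Longrightarrow> t 0 = u 0 \<Longrightarrow> lex_less_within L t u \<Longrightarrow> code_val u \<le> code_val t"
  unfolding lex_less_within_def using code_val_lex(1) by blast

lemma code_val_bounds:
  assumes t: "sign_seq t" and "t 0 = 1"
  shows "0 \<le> code_val t" "code_val t \<le> 1"
proof -
  have s: "summable (\<lambda>m. \<bar>w m * t (Suc m)\<bar>)" and le: "\<bar>w m * t (Suc m)\<bar> \<le> w m" for m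
    using summable_w sign_seqD [OF t] w_pos
    by (auto simp: abs_mult less_imp_le intro!: summable_comparison_test' [OF summable_w, of 0])
       (metis abs_minus_cancel abs_one dual_order.refl less_imp_le mult.right_neutral)+
  have "\<bar>\<Sum>m. w m * t (Suc m)\<bar> \<le> (\<Sum>m. \<bar>w m * t (Suc m)\<bar>)" by (rule summable_rabs [OF s])
  also have "\<dots> \<le> (\<Sum>m. w m)" by (rule suminf_le [OF le s summable_w])
  also have "\<dots> = 1" using w_sums [of 0] by (simp add: sums_iff)
  finally show "0 \<le> code_val t" "code_val t \<le> 1"
    using assms by (auto simp: code_val_eq)
qed

lemma code_val_ge_half:
  assumes t: "sign_seq t" and "t 0 = 1" "t 1 = -1"
  shows "1 / 2 \<le> code_val t"
proof -
  have s: "summable (\<lambda>m. w m * t (Suc m))"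
    by (rule summable_w_bounded, rule sign_seq_abs, rule t)
  have le: "w (m + 1) * t (Suc (Suc m)) \<le> w (m + 1)" for m
    using sign_seqD [OF t, of "Suc (Suc m)"] w_pos [of "m + 1"] by auto
  have "(\<Sum>m. w m * t (Suc m)) = - w 0 + (\<Sum>m. w (m + 1) * t (Suc (Suc m)))"
    using suminf_split_head [OF s] assms by simp
  also have "(\<Sum>m. w (m + 1) * t (Suc (Suc m))) \<le> (\<Sum>m. w (m + 1))"
    using s summable_w
    by (intro suminf_le [OF le]) (simp_all add: summable_Suc_iff [where f = "\<lambda>m. w m * t (Suc m)"] summable_Suc_iff)
  also have "\<dots> = h 1" using w_sums [of 1] by (simp add: sums_iff)
  finally show ?thesis using assms w_ge [of 0] by (simp add: code_val_eq)
qed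

lemma weighted_tail_code:
  assumes "sign_seq t" "\<And>n. s n = (t n - t (Suc n)) / 2"
  shows "\<bar>weighted_tail s n\<bar> = code_val (signed_tail t n)"
proof -
  have pm: "sign_seq (\<lambda>i. t (n + i))" using assms(1) by (simp add: sign_seq_def)
  have "weighted_tail s n = code_val (\<lambda>i. t (n + i))"
    by (simp add: weighted_tail_def code_val_def assms(2))
  moreover have "code_val (signed_tail t n) = t n * code_val (\<lambda>i. t (n + i))"
    using code_val_scale [OF pm, of "t n"] by (simp add: signed_tail_def [abs_def])
  moreover have "0 \<le> code_val (signed_tail t n)"
    by (intro code_val_bounds sign_seq_signed_tail signed_tail_0 assms)
  ultimately show ?thesis using sign_seqD [OF assms(1), of n] by auto
qed

text \<open>Two equal nonzero entries at distance \<open>j\<close> with zeros between contribute \<open>1 + h\<^sub>j\<close>, and all the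
  later entries together can take away at most \<open>h\<^sub>j\<close>.\<close>

lemma no_repeated_sign:
  assumes s: "\<And>n. \<bar>s n\<bar> \<le> 1" and small: "\<bar>weighted_tail s n\<bar> < 1"
    and b: "\<bar>s n\<bar> = 1" and "j > 0" and zero: "\<And>i. 0 < i \<Longrightarrow> i < j \<Longrightarrow> s (n + i) = 0"
  shows "s (n + j) \<noteq> s n"
proof
  assume eq: "s (n + j) = s n"
  have sm: "summable (\<lambda>m. h m * s (n + m))" by (rule summable_bounded, rule s)
  let ?R = "\<Sum>m. h (m + Suc j) * s (n + (m + Suc j))"
  have le: "\<bar>h (m + Suc j) * s (n + (m + Suc j))\<bar> \<le> h (m + Suc j)" for m
    using h_pos [of "m + Suc j"] s [of "n + (m + Suc j)"] by (simp add: abs_mult mult_left_le)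
  have sh: "summable (\<lambda>m. h (m + Suc j))"
    by (rule summable_ignore_initial_segment [OF summable_h])
  have sa: "summable (\<lambda>m. \<bar>h (m + Suc j) * s (n + (m + Suc j))\<bar>)"
    by (rule summable_comparison_test' [OF sh, of 0]) (use le in simp)
  have "\<bar>?R\<bar> \<le> (\<Sum>m. \<bar>h (m + Suc j) * s (n + (m + Suc j))\<bar>)" by (rule summable_rabs [OF sa])
  also have "\<dots> \<le> (\<Sum>m. h (m + Suc j))" by (rule suminf_le [OF le sa sh])
  also have "\<dots> \<le> h j" by (rule tail_le)
  finally have R: "\<bar>?R\<bar> \<le> h j" .
  have "(\<Sum>m<Suc j. h m * s (n + m)) = (\<Sum>m\<in>{0, j}. h m * s (n + m))"
    by (rule sum.mono_neutral_right) (auto intro: zero simp: less_Suc_eq)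
  also have "\<dots> = s n * (1 + h j)" using \<open>j > 0\<close> eq by (simp add: algebra_simps)
  finally have "weighted_tail s n = ?R + s n * (1 + h j)"
    using suminf_split_initial_segment [OF sm, of "Suc j"] by (simp add: weighted_tail_def)
  then show False using R small b h_pos [of j] by (auto simp: abs_if split: if_splits)
qed

text \<open>Take for \<open>t\<^sub>n\<close> the first nonzero entry of \<open>s\<close> from position \<open>n\<close> on.\<close>

lemma alternating_code:
  assumes s: "\<And>n. s n \<in> {-1, 0, 1}" and small: "\<And>n. \<bar>weighted_tail s n\<bar> < 1"
    and inf: "\<And>N. \<exists>n\<ge>N. s n \<noteq> 0"
  obtains t where "sign_seq t" "\<And>n. s n = (t n - t (Suc n)) / 2"
proof -
  define nxt where "nxt n = (LEAST m. m \<ge> n \<and> s m \<noteq> 0)" for n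
  have nxt: "nxt n \<ge> n" "s (nxt n) \<noteq> 0" for n
    using LeastI_ex [OF inf [of n]] by (simp_all add: nxt_def)
  have least: "s i = 0" if "n \<le> i" "i < nxt n" for i n
    using not_less_Least [of i "\<lambda>m. m \<ge> n \<and> s m \<noteq> 0"] that by (auto simp: nxt_def)
  define t where "t n = s (nxt n)" for n
  have pm: "sign_seq t" unfolding sign_seq_def t_def using s nxt(2) by blast
  have abs_s: "\<bar>s n\<bar> \<le> 1" for n using s [of n] by auto
  have "s n = (t n - t (Suc n)) / 2" for n
  proof (cases "s n = 0")
    case True
    have "nxt n \<noteq> n" using True nxt(2) [of n] by auto
    then have "nxt n \<ge> Suc n" using nxt(1) [of n] by simp
    have "nxt (Suc n) = nxt n"
    proof (rule antisym)
      show "nxt (Suc n) \<le> nxt n"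
        unfolding nxt_def [of "Suc n"] using \<open>nxt n \<ge> Suc n\<close> nxt(2) by (intro Least_le) simp
      show "nxt n \<le> nxt (Suc n)"
        unfolding nxt_def [of n] using nxt [of "Suc n"] by (intro Least_le) simp
    qed
    then show ?thesis using True by (simp add: t_def)
  next
    case False
    have "nxt n = n" using least [of n n] nxt(1) [of n] False by (metis le_less order.refl)
    then have tn: "t n = s n" by (simp add: t_def)
    define j where "j = nxt (Suc n) - n"
    have j: "j > 0" "n + j = nxt (Suc n)" using nxt(1) [of "Suc n"] by (auto simp: j_def)
    have "s (n + j) \<noteq> s n"
    proof (rule no_repeated_sign [OF abs_s small])
      show "\<bar>s n\<bar> = 1" using s [of n] False by auto
      show "s (n + i) = 0" if "0 < i" "i < j" for i
        using that j by (intro least [of "Suc n"]) auto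
    qed (use j in simp)
    then have "t (Suc n) \<noteq> t n" using tn j by (simp add: t_def)
    then show ?thesis
      using tn sign_seqD [OF pm, of n] sign_seqD [OF pm, of "Suc n"] by auto
  qed
  with pm show ?thesis by (rule that)
qed

text \<open>Sequences that agree with Thue-Morse on a long prefix have nearly the Thue-Morse value, and those
  below it have at least that value. The gap \<open>\<eta>\<close> therefore puts every signed tail above Thue-Morse
  within a bounded number of letters, and the rigidity theorem applies.\<close>

theorem small_weighted_tails_periodic:
  assumes s: "\<And>n. s n \<in> {-1, 0, 1}" and inf: "\<And>N. \<exists>n\<ge>N. s n \<noteq> 0"
    and "\<eta> > 0" and small: "\<And>n. \<bar>weighted_tail s n\<bar> \<le> code_val thue_morse - \<eta>"
  obtains k M where "\<And>n. \<bar>weighted_tail s (M + n)\<bar> = code_val (signed_tail (periodic_tm k) n)"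
proof -
  note tm = sign_seq_thue_morse
  have "\<bar>weighted_tail s n\<bar> < 1" for n
    using small [of n] \<open>\<eta> > 0\<close> code_val_bounds(2) [OF tm] by simp
  then obtain t where t: "sign_seq t" and st: "\<And>n. s n = (t n - t (Suc n)) / 2"
    using alternating_code [OF s _ inf] by blast
  obtain L where L: "h L < \<eta>"
    using order_tendstoD(2) [OF h_tendsto_0 \<open>\<eta> > 0\<close>] by (auto simp: eventually_sequentially)
  have lex: "lex_less_within L thue_morse (signed_tail t n)" for n
  proof (rule ccontr)
    assume not: "\<not> ?thesis"
    let ?u = "signed_tail t n"
    have u: "sign_seq ?u" "?u 0 = 1" by (simp_all add: sign_seq_signed_tail signed_tail_0 t)
    have val: "code_val ?u \<le> code_val thue_morse - \<eta>"
      using small [of n] weighted_tail_code [OF t st, of n] by simp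
    show False
    proof (cases "\<forall>i\<le>L. thue_morse i = ?u i")
      case True
      then show False using code_val_close [OF tm u(1), of L] val L by auto
    next
      case False
      then obtain i where i: "i \<le> L" "thue_morse i \<noteq> ?u i" by blast
      define j where "j = (LEAST j. thue_morse j \<noteq> ?u j)"
      have j: "thue_morse j \<noteq> ?u j" "\<And>i. i < j \<Longrightarrow> ?u i = thue_morse i" "j \<le> L"
      proof -
        show "thue_morse j \<noteq> ?u j" unfolding j_def by (rule LeastI [of _ i]) (rule i)
        show "?u i = thue_morse i" if "i < j" for i
          using not_less_Least [of i "\<lambda>j. thue_morse j \<noteq> ?u j"] that by (auto simp: j_def)
        show "j \<le> L" unfolding j_def using i by (intro order.trans [OF Least_le [of _ i]])
      qed
      have "\<not> thue_morse j < ?u j" using not j by (auto simp: lex_less_within_def)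
      then have "code_val thue_morse \<le> code_val ?u"
        using j u by (intro code_val_lex(1) [OF u(1) tm, of j]) auto
      then show False using val \<open>\<eta> > 0\<close> by simp
    qed
  qed
  have "\<exists>n\<ge>N. t (Suc n) \<noteq> t n" for N using inf [of N] st by auto
  from thue_morse_rigidity [OF t lex this]
  obtain k M where kM: "\<And>n. t (M + n) = t M * periodic_tm k n" by blast
  have "t M * t M = 1" using sign_seqD [OF t, of M] by auto
  then have "signed_tail t (M + n) = signed_tail (periodic_tm k) n" for n
    by (intro ext) (simp add: signed_tail_def add.assoc kM)
  then have "\<bar>weighted_tail s (M + n)\<bar> = code_val (signed_tail (periodic_tm k) n)" for n
    using weighted_tail_code [OF t st, of "M + n"] by simp
  then show ?thesis by (rule that)
qed

lemma code_val_periodic_tail_le: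
  "code_val (signed_tail (periodic_tm k) n) \<le> code_val (periodic_tm k)"
  using periodic_tm_lex_minimal [of k n]
proof
  assume "\<exists>L. lex_less_within L (periodic_tm k) (signed_tail (periodic_tm k) n)"
  then show ?thesis
    by (auto intro!: code_val_lex_within sign_seq_signed_tail sign_seq_periodic_tm
        simp: signed_tail_0 sign_seq_periodic_tm)
qed simp

lemma signed_tail_periodic_tm: "signed_tail (periodic_tm k) (2 ^ Suc k * q) = periodic_tm k"
  using periodic_tm_period [of k 0 q] periodic_tm_period [of k _ q]
  by (intro ext) (simp add: signed_tail_def add.commute)

text \<open>The two sequences first differ at position \<open>2\<^sup>k\<^sup>+\<^sup>1\<close>, where the periodic one starts again with \<open>1\<close>.\<close>

lemma code_val_periodic_less: "code_val (periodic_tm k) < code_val thue_morse"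
proof (rule code_val_lex(2) [OF sign_seq_thue_morse sign_seq_periodic_tm])
  let ?j = "2 ^ Suc k :: nat"
  have per: "periodic_tm k (?j * q) = 1" for q
    using periodic_tm_period [of k 0 q] by simp
  show "thue_morse i = periodic_tm k i" if "i < ?j" for i
    using periodic_tm_eq_thue_morse [OF that] by simp
  show "thue_morse ?j < periodic_tm k ?j"
    using per [of 1] thue_morse_power2 [of "Suc k"] by simp
  show "\<exists>i>?j. periodic_tm k i = 1" using per [of 2] by (intro exI [of _ "?j * 2"]) simp
qed simp

lemma code_val_periodic_tendsto: "(\<lambda>k. code_val (periodic_tm k)) \<longlonglongrightarrow> code_val thue_morse"
proof -
  have "\<bar>code_val (periodic_tm k) - code_val thue_morse\<bar> \<le> h k" for k
  proof (rule code_val_close [OF sign_seq_periodic_tm sign_seq_thue_morse periodic_tm_eq_thue_morse])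
    show "i < 2 ^ Suc k" if "i \<le> k" for i
      using that less_exp [of "Suc k"] by linarith
  qed
  then show ?thesis
    by (intro LIMSEQ_I) (metis (no_types) LIMSEQ_D [OF h_tendsto_0] diff_zero abs_of_pos h_pos
        order.strict_trans1 real_norm_def)
qed

lemma code_val_periodic_pos: "0 < code_val (periodic_tm k)"
  using code_val_ge_half [OF sign_seq_periodic_tm, of k] by simp

end

section \<open>Generating functions of the Thue-Morse codes\<close>

lemma sign_seq_power_summable:
  fixes x :: real
  assumes "sign_seq t" "0 \<le> x" "x < 1"
  shows "summable (\<lambda>m. t m * x ^ m)"
proof (rule summable_comparison_test' [of "\<lambda>m. x ^ m" 0])
  show "summable (\<lambda>m. x ^ m)" using assms by (intro summable_geometric) simp
  show "norm (t n * x ^ n) \<le> x ^ n" for n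
    using sign_seqD [OF assms(1), of n] assms(2) by (auto simp: abs_mult)
qed

text \<open>Grouping the terms in pairs turns the substitution into a functional equation, whose iteration
  produces the products in the definitions of \<open>E\<close> and \<open>E_trunc\<close>.\<close>

lemma doubling_power_series:
  fixes x :: real
  assumes "sign_seq t" "0 \<le> x" "x < 1"
  shows "(\<Sum>m. doubling t m * x ^ m) = (1 - x) * (\<Sum>m. t m * (x\<^sup>2) ^ m)"
proof -
  have x2: "0 \<le> x\<^sup>2" "x\<^sup>2 < 1" using assms by (auto simp: power_less_one_iff)
  have s: "(\<lambda>m. doubling t m * x ^ m) sums (\<Sum>m. doubling t m * x ^ m)"
    by (intro summable_sums sign_seq_power_summable sign_seq_doubling assms)
  have "(\<lambda>n. \<Sum>m\<in>{n*2..<n*2+2}. doubling t m * x ^ m) sums (\<Sum>m. doubling t m * x ^ m)"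
    by (rule sums_group [OF s]) simp
  moreover have "(\<Sum>m\<in>{n*2..<n*2+2}. doubling t m * x ^ m) = (1 - x) * (t n * (x\<^sup>2) ^ n)" for n
  proof -
    have "{n*2..<n*2+2} = {2 * n, Suc (2 * n)}" by auto
    moreover have "x ^ (2 * n) = (x\<^sup>2) ^ n" by (rule power_mult)
    ultimately show ?thesis by (simp add: left_diff_distrib)
  qed
  ultimately have "(\<lambda>n. (1 - x) * (t n * (x\<^sup>2) ^ n)) sums (\<Sum>m. doubling t m * x ^ m)" by simp
  moreover have "(\<lambda>n. (1 - x) * (t n * (x\<^sup>2) ^ n)) sums ((1 - x) * (\<Sum>m. t m * (x\<^sup>2) ^ m))"
    by (intro sums_mult summable_sums sign_seq_power_summable assms x2)
  ultimately show ?thesis by (rule sums_unique2)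
qed

lemma code_power_series:
  fixes x :: real
  assumes t: "sign_seq t" "t 0 = 1" and x: "0 < x" "x < 1"
  shows "(\<lambda>m. (t m - t (Suc m)) / 2 * x ^ m) sums
    ((1 - (1 - x) * (\<Sum>m. t m * x ^ m)) / (2 * x))"
proof -
  let ?S = "\<Sum>m. t m * x ^ m"
  have s: "(\<lambda>m. t m * x ^ m) sums ?S"
    using x by (intro summable_sums sign_seq_power_summable t) auto
  then have "(\<lambda>m. t (Suc m) * x ^ Suc m) sums (?S - 1)"
    using t(2) by (subst sums_Suc_iff [where f = "\<lambda>m. t m * x ^ m"]) simp
  then have "(\<lambda>m. t (Suc m) * x ^ Suc m / x) sums ((?S - 1) / x)"
    by (rule sums_divide)
  then have "(\<lambda>m. t (Suc m) * x ^ m) sums ((?S - 1) / x)" using x by simp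
  from sums_divide [OF sums_diff [OF s this], of 2]
  have "(\<lambda>m. (t m * x ^ m - t (Suc m) * x ^ m) / 2) sums ((?S - (?S - 1) / x) / 2)" .
  moreover have "(?S - (?S - 1) / x) / 2 = (1 - (1 - x) * ?S) / (2 * x)"
    using x by (simp add: field_simps)
  ultimately show ?thesis by (simp add: left_diff_distrib diff_divide_distrib)
qed

lemma periodic_tm_power_series:
  fixes x :: real
  assumes "0 \<le> x" "x < 1"
  shows "(\<Sum>m. periodic_tm k m * x ^ m) = (\<Prod>m<k. 1 - x ^ 2 ^ m) / (1 + x ^ 2 ^ k)"
  using assms
proof (induction k arbitrary: x)
  case 0
  have "(\<Sum>m. (-1) ^ m * x ^ m) = (\<Sum>m. (- x) ^ m)"
    by (simp flip: power_mult_distrib)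
  also have "\<dots> = 1 / (1 + x)" using 0 by (subst suminf_geometric) auto
  finally show ?case by simp
next
  case (Suc k)
  have x2: "0 \<le> x\<^sup>2" "x\<^sup>2 < 1" using Suc.prems by (auto simp: power_less_one_iff)
  have "(\<Sum>m. periodic_tm (Suc k) m * x ^ m) = (1 - x) * (\<Sum>m. periodic_tm k m * (x\<^sup>2) ^ m)"
    using doubling_power_series [OF sign_seq_periodic_tm Suc.prems] by simp
  also have "\<dots> = (1 - x) * (\<Prod>m<k. 1 - x ^ 2 ^ Suc m) / (1 + x ^ 2 ^ Suc k)"
    by (subst Suc.IH [OF x2]) (simp flip: power_mult)
  also have "(1 - x) * (\<Prod>m<k. 1 - x ^ 2 ^ Suc m) = (\<Prod>m<Suc k. 1 - x ^ 2 ^ m)"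
    by (subst prod.lessThan_Suc_shift) simp
  finally show ?case .
qed

lemma E_trunc_sums:
  assumes "0 < x" "x < 1"
  shows "(\<lambda>m. (periodic_tm k m - periodic_tm k (Suc m)) / 2 * x ^ m) sums E_trunc k x"
proof -
  have "1 + x ^ 2 ^ k > 0" using assms by (intro add_pos_pos) auto
  then have "(1 - (1 - x) * ((\<Prod>m<k. 1 - x ^ 2 ^ m) / (1 + x ^ 2 ^ k))) / (2 * x) = E_trunc k x"
    using assms unfolding E_trunc_def by (simp add: divide_simps)
  then show ?thesis
    using code_power_series [OF sign_seq_periodic_tm _ assms, of k] assms
    by (simp add: periodic_tm_power_series)
qed

lemma thue_morse_power_series:
  fixes x :: real
  assumes "0 \<le> x" "x < 1"
  shows "(\<Sum>m. thue_morse m * x ^ m) = (\<Prod>m. 1 - x ^ 2 ^ m)"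
proof -
  let ?S = "\<lambda>x::real. \<Sum>m. thue_morse m * x ^ m"
  have step: "?S x = (\<Prod>m<k. 1 - x ^ 2 ^ m) * ?S (x ^ 2 ^ k)" for k
  proof (induction k)
    case (Suc k)
    have "?S (x ^ 2 ^ k) = (1 - x ^ 2 ^ k) * ?S ((x ^ 2 ^ k)\<^sup>2)"
      using doubling_power_series [OF sign_seq_thue_morse, of "x ^ 2 ^ k"] assms
      by (simp add: power_less_one_iff)
    with Suc show ?case by (simp flip: power_mult) (simp add: mult.commute)
  qed simp
  have tend0: "(\<lambda>k. x ^ 2 ^ k) \<longlonglongrightarrow> 0"
    using LIMSEQ_subseq_LIMSEQ [OF LIMSEQ_power_zero [of x], of "\<lambda>k. 2 ^ k"] assms
    by (simp add: strict_mono_def o_def)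
  have cont: "isCont ?S 0"
  proof -
    have "summable (\<lambda>m. thue_morse m * (1 / 2) ^ m)"
      by (intro sign_seq_power_summable sign_seq_thue_morse) auto
    then show ?thesis by (rule isCont_powser) simp
  qed
  have "?S 0 = 1" by (simp add: powser_zero)
  then have S1: "(\<lambda>k. ?S (x ^ 2 ^ k)) \<longlonglongrightarrow> 1"
    using isCont_tendsto_compose [OF cont tend0] by simp
  have le: "x ^ 2 ^ m \<le> x ^ m" for m
    using assms by (intro power_decreasing) auto
  have "summable (\<lambda>m. norm (- (x ^ 2 ^ m)))"
    by (rule summable_comparison_test' [OF summable_geometric [of x], of 0]) (use assms le in auto)
  then have "convergent_prod (\<lambda>m. 1 + - (x ^ 2 ^ m))"
    by (intro abs_convergent_prod_imp_convergent_prod)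
      (simp add: abs_convergent_prod_conv_summable)
  then have "(\<lambda>k. \<Prod>m\<le>k. 1 - x ^ 2 ^ m) \<longlonglongrightarrow> (\<Prod>m. 1 - x ^ 2 ^ m)"
    using convergent_prod_LIMSEQ by force
  then have P: "(\<lambda>k. \<Prod>m<k. 1 - x ^ 2 ^ m) \<longlonglongrightarrow> (\<Prod>m. 1 - x ^ 2 ^ m)"
    by (subst (asm) LIMSEQ_lessThan_iff_atMost [symmetric, where f = "\<lambda>A. \<Prod>m\<in>A. 1 - x ^ 2 ^ m"])
  have "(\<lambda>k. (\<Prod>m<k. 1 - x ^ 2 ^ m) * ?S (x ^ 2 ^ k)) \<longlonglongrightarrow> (\<Prod>m. 1 - x ^ 2 ^ m) * 1"
    by (intro tendsto_mult P S1)
  then have "(\<lambda>k::nat. ?S x) \<longlonglongrightarrow> (\<Prod>m. 1 - x ^ 2 ^ m)"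
    by (simp flip: step)
  then show ?thesis by (simp add: LIMSEQ_const_iff)
qed

lemma E_sums:
  assumes "0 < x" "x < 1"
  shows "(\<lambda>m. (thue_morse m - thue_morse (Suc m)) / 2 * x ^ m) sums E x"
  using code_power_series [OF sign_seq_thue_morse _ assms] assms
  by (simp add: thue_morse_power_series E_def)

section \<open>Complete homogeneous symmetric polynomials\<close>

text \<open>By Lagrange interpolation this is the complete homogeneous symmetric polynomial of degree
  \<open>k - (card A - 1)\<close> in the values of \<open>x\<close> if these are distinct, and \<open>0\<close> for smaller \<open>k\<close>. The form with
  denominators is the one that occurs in \<open>interp\<close>, and the recursion below replaces the
  combinatorial description.\<close>

definition lagrange_power_sum :: "'i set \<Rightarrow> ('i \<Rightarrow> 'a::field) \<Rightarrow> nat \<Rightarrow> 'a" where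
  "lagrange_power_sum A x k = (\<Sum>i\<in>A. x i ^ k / (\<Prod>j\<in>A - {i}. x i - x j))"

lemma lagrange_power_sum_remove:
  assumes "finite A" "inj_on x A" "l \<in> A"
  shows "lagrange_power_sum A x (Suc k) =
    x l * lagrange_power_sum A x k + lagrange_power_sum (A - {l}) x k"
proof -
  have "lagrange_power_sum A x (Suc k) - x l * lagrange_power_sum A x k =
      (\<Sum>i\<in>A. x i ^ k * (x i - x l) / (\<Prod>j\<in>A - {i}. x i - x j))"
    by (simp add: lagrange_power_sum_def sum_distrib_left sum_subtractf [symmetric]
        diff_divide_distrib [symmetric] algebra_simps)
  also have "\<dots> = (\<Sum>i\<in>A - {l}. x i ^ k * (x i - x l) / (\<Prod>j\<in>A - {i}. x i - x j))"
    by (intro sum.mono_neutral_right) (use assms in auto)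
  also have "\<dots> = lagrange_power_sum (A - {l}) x k"
    unfolding lagrange_power_sum_def
  proof (intro sum.cong refl)
    fix i assume i: "i \<in> A - {l}"
    have "(\<Prod>j\<in>A - {i}. x i - x j) = (x i - x l) * (\<Prod>j\<in>A - {i} - {l}. x i - x j)"
      using assms i by (intro prod.remove) auto
    moreover have "A - {i} - {l} = A - {l} - {i}" by auto
    moreover have "x i - x l \<noteq> 0" using assms i by (auto simp: inj_on_def)
    ultimately show "x i ^ k * (x i - x l) / (\<Prod>j\<in>A - {i}. x i - x j) =
        x i ^ k / (\<Prod>j\<in>A - {l} - {i}. x i - x j)" by simp
  qed
  finally show ?thesis by (simp add: algebra_simps)
qed

text \<open>The sum with exponent \<open>0\<close> over at least two nodes vanishes because the recursion, applied to two
  different nodes, gives two expressions for the sum with exponent \<open>1\<close>.\<close>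

lemma lagrange_power_sum_low:
  assumes "finite A" "inj_on x A" "card A = Suc n"
  shows "k \<le> n \<Longrightarrow> lagrange_power_sum A x k = (if k = n then 1 else 0)"
  using assms
proof (induction n arbitrary: A k)
  case 0
  then obtain a where "A = {a}" by (auto simp: card_1_singleton_iff)
  then show ?case using 0 by (simp add: lagrange_power_sum_def)
next
  case (Suc n)
  have IH: "lagrange_power_sum (A - {l}) x k = (if k = n then 1 else 0)" if "l \<in> A" "k \<le> n" for l k
    using that Suc.prems by (intro Suc.IH) (auto intro: inj_on_subset)
  have zero: "lagrange_power_sum A x 0 = 0"
  proof -
    obtain l where l: "l \<in> A" using Suc.prems by (metis card.empty ex_in_conv nat.distinct(1))
    have "A - {l} \<noteq> {}" using Suc.prems l by (metis card.empty card_Suc_Diff1 nat.inject nat.distinct(1))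
    then obtain m where m: "m \<in> A" "m \<noteq> l" by blast
    have "x l * lagrange_power_sum A x 0 + lagrange_power_sum (A - {l}) x 0 =
        x m * lagrange_power_sum A x 0 + lagrange_power_sum (A - {m}) x 0"
      using lagrange_power_sum_remove [OF Suc.prems(2,3) l, of 0]
        lagrange_power_sum_remove [OF Suc.prems(2,3) m(1), of 0] by (simp only:)
    then have "x l * lagrange_power_sum A x 0 = x m * lagrange_power_sum A x 0"
      using IH [OF l, of 0] IH [OF m(1), of 0] by (simp only: add_right_cancel le0)
    moreover have "x l \<noteq> x m" using Suc.prems(3) l m by (auto simp: inj_on_def)
    ultimately show ?thesis by simp
  qed
  have "lagrange_power_sum A x k = (if k = Suc n then 1 else 0)" if "k \<le> Suc n" for k
    using that
  proof (induction k)
    case (Suc k)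
    obtain l where l: "l \<in> A" using Suc.prems \<open>card A = _\<close> by (metis card.empty ex_in_conv nat.distinct(1))
    show ?case
      using lagrange_power_sum_remove [OF \<open>finite A\<close> \<open>inj_on x A\<close> l, of k] IH [OF l, of k] Suc
      by simp
  qed (simp add: zero)
  then show ?case using Suc.prems by simp
qed

definition complete_homogeneous :: "'i set \<Rightarrow> ('i \<Rightarrow> 'a::field) \<Rightarrow> nat \<Rightarrow> 'a" where
  "complete_homogeneous A x m = lagrange_power_sum A x (m + (card A - 1))"

lemma complete_homogeneous_0:
  "finite A \<Longrightarrow> A \<noteq> {} \<Longrightarrow> inj_on x A \<Longrightarrow> complete_homogeneous A x 0 = 1"
  using lagrange_power_sum_low [of A x "card A - 1" "card A - 1"]
  by (simp add: complete_homogeneous_def card_gt_0_iff)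

lemma complete_homogeneous_singleton [simp]: "complete_homogeneous {i} x m = x i ^ m"
  by (simp add: complete_homogeneous_def lagrange_power_sum_def)

lemma complete_homogeneous_insert:
  assumes "finite A" "A \<noteq> {}" "l \<notin> A" "inj_on x (insert l A)"
  shows "complete_homogeneous (insert l A) x (Suc m) =
    x l * complete_homogeneous (insert l A) x m + complete_homogeneous A x (Suc m)"
proof -
  have "card (insert l A) - 1 = Suc (card A - 1)" using assms by (simp add: card_gt_0_iff)
  then show ?thesis
    using assms lagrange_power_sum_remove [of "insert l A" x l "m + Suc (card A - 1)"]
    by (simp add: complete_homogeneous_def)
qed

text \<open>By induction on the set of variables, using \<open>H(A \<union> {l}, m + 1) = x\<^sub>l H(A \<union> {l}, m) + H(A, m + 1)\<close> and
  the monotonicity of \<open>H\<close> in the set of variables.\<close>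

lemma complete_homogeneous_growth:
  fixes x :: "'i \<Rightarrow> real"
  assumes "finite A" "A \<noteq> {}" "inj_on x A" "\<And>i. i \<in> A \<Longrightarrow> x i > 0"
  shows "complete_homogeneous A x m > 0 \<and>
    complete_homogeneous A x (Suc m) \<le> sum x A * complete_homogeneous A x m"
  using assms
proof (induction A arbitrary: m rule: finite_ne_induct)
  case (insert l A)
  let ?H = "complete_homogeneous (insert l A) x" and ?G = "complete_homogeneous A x"
  have xl: "x l > 0" and inj: "inj_on x A" using insert.prems by auto
  have G: "?G m > 0" "?G (Suc m) \<le> sum x A * ?G m" for m
    using insert.IH [OF inj] insert.prems by auto
  note rec = complete_homogeneous_insert [OF insert.hyps(1,2,3) insert.prems(1)]
  have H: "?H m \<ge> ?G m" for m
  proof (induction m)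
    case 0 show ?case
      using insert.hyps insert.prems(1) inj by (simp add: complete_homogeneous_0)
  next
    case (Suc m)
    then have "?H m > 0" using G(1) [of m] by linarith
    then show ?case using rec [of m] xl by simp
  qed
  have "?H m > 0" using H [of m] G(1) [of m] by linarith
  moreover have "?H (Suc m) \<le> x l * ?H m + sum x A * ?H m"
  proof -
    have "sum x A * ?G m \<le> sum x A * ?H m"
      using H [of m] insert.prems(2) by (intro mult_left_mono sum_nonneg) (auto intro: less_imp_le)
    then show ?thesis using rec [of m] G(2) [of m] by linarith
  qed
  ultimately show ?case using insert.hyps by (simp add: distrib_right)
qed simp

lemma complete_homogeneous_eq_sum:
  assumes "finite A"
  shows "complete_homogeneous A x m = (\<Sum>i\<in>A. (\<Prod>j\<in>A - {i}. x i / (x i - x j)) * x i ^ m)"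
  unfolding complete_homogeneous_def lagrange_power_sum_def
proof (intro sum.cong refl)
  fix i assume "i \<in> A"
  then have "card (A - {i}) = card A - 1" using assms by simp
  then show "x i ^ (m + (card A - 1)) / (\<Prod>j\<in>A - {i}. x i - x j) =
      (\<Prod>j\<in>A - {i}. x i / (x i - x j)) * x i ^ m"
    by (simp add: prod_dividef power_add)
qed

text \<open>Interpolation at \<open>X\<^sub>1, \<dots>, X\<^sub>d\<close> replaces powers by complete homogeneous polynomials, term by term.\<close>

lemma interp_sums:
  assumes "\<And>i. i \<in> {1..d} \<Longrightarrow> (\<lambda>m. c m * X i ^ m) sums F (X i)"
  shows "(\<lambda>m. complete_homogeneous {1..d} X m * c m) sums interp F d X"
proof -
  have "(\<lambda>m. \<Sum>i\<in>{1..d}. (\<Prod>j\<in>{1..d} - {i}. X i / (X i - X j)) * (c m * X i ^ m))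
      sums interp F d X"
    unfolding interp_def by (intro sums_sum sums_mult assms)
  moreover have "(\<Sum>i\<in>{1..d}. (\<Prod>j\<in>{1..d} - {i}. X i / (X i - X j)) * (c m * X i ^ m)) =
      complete_homogeneous {1..d} X m * c m" for m
  proof -
    have "(\<Sum>i\<in>{1..d}. (\<Prod>j\<in>{1..d} - {i}. X i / (X i - X j)) * (c m * X i ^ m)) =
        (\<Sum>i\<in>{1..d}. (\<Prod>j\<in>{1..d} - {i}. X i / (X i - X j)) * X i ^ m) * c m"
      unfolding sum_distrib_right by (intro sum.cong refl) (simp only: mult_ac)
    then show ?thesis by (simp add: complete_homogeneous_eq_sum)
  qed
  ultimately show ?thesis by simp
qed

section \<open>Linear recurrences modulo the integers\<close>

lemma infdist_Ints_eq:
  fixes e :: real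
  assumes "z \<in> \<int>" "\<bar>e\<bar> \<le> 1 / 2"
  shows "infdist (z + e) \<int> = \<bar>e\<bar>"
proof (rule antisym)
  show "infdist (z + e) \<int> \<le> \<bar>e\<bar>"
    using infdist_le [OF assms(1), of "z + e"] by (simp add: dist_real_def)
  have Ints_nonempty: "(\<int> :: real set) \<noteq> {}" using assms(1) by auto
  show "\<bar>e\<bar> \<le> infdist (z + e) \<int>"
    unfolding infdist_notempty [OF Ints_nonempty]
  proof (rule cINF_greatest [OF Ints_nonempty])
    fix y :: real assume "y \<in> \<int>"
    then have "z - y \<in> \<int>" using assms(1) by simp
    then obtain k where k: "z - y = of_int k" by (auto elim: Ints_cases)
    have "\<bar>e\<bar> \<le> \<bar>of_int k + e\<bar>"
    proof (cases "k = 0")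
      case False
      then have "\<bar>of_int k :: real\<bar> \<ge> 1" by linarith
      then show ?thesis using assms(2) by linarith
    qed simp
    then show "\<bar>e\<bar> \<le> dist (z + e) y" using k by (simp add: dist_real_def algebra_simps)
  qed
qed

lemma sum_abs_coeff_prod_linear:
  fixes x :: "'i \<Rightarrow> real"
  assumes "finite A"
  shows "(\<Sum>j\<le>card A. \<bar>coeff (\<Prod>i\<in>A. [:- x i, 1:]) j\<bar>) \<le> (\<Prod>i\<in>A. 1 + \<bar>x i\<bar>)"
  using assms
proof (induction A rule: finite_induct)
  case (insert a A)
  let ?p = "\<Prod>i\<in>A. [:- x i, 1:]"
  let ?S = "\<Sum>j\<le>card A. \<bar>coeff ?p j\<bar>"
  have deg: "degree ?p \<le> card A"
    using degree_prod_sum_le [OF insert.hyps(1), of "\<lambda>i. [:- x i, 1:]"] by simp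
  have eq: "[:- x a, 1:] * ?p = smult (- x a) ?p + pCons 0 ?p" by simp
  have "(\<Sum>j\<le>Suc (card A). \<bar>coeff ([:- x a, 1:] * ?p) j\<bar>) \<le>
      (\<Sum>j\<le>Suc (card A). \<bar>x a\<bar> * \<bar>coeff ?p j\<bar> + \<bar>coeff (pCons 0 ?p) j\<bar>)"
    unfolding eq by (intro sum_mono) (simp add: abs_mult [symmetric] abs_triangle_ineq4 abs_minus_commute)
  also have "\<dots> = \<bar>x a\<bar> * (\<Sum>j\<le>Suc (card A). \<bar>coeff ?p j\<bar>) + (\<Sum>j\<le>Suc (card A). \<bar>coeff (pCons 0 ?p) j\<bar>)"
    by (simp only: sum.distrib sum_distrib_left)
  also have "(\<Sum>j\<le>Suc (card A). \<bar>coeff ?p j\<bar>) = ?S"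
    using deg by (simp add: coeff_eq_0)
  also have "(\<Sum>j\<le>Suc (card A). \<bar>coeff (pCons 0 ?p) j\<bar>) = ?S"
    by (subst sum.atMost_Suc_shift) simp
  also have "\<bar>x a\<bar> * ?S + ?S = (1 + \<bar>x a\<bar>) * ?S" by (simp add: algebra_simps)
  also have "\<dots> \<le> (1 + \<bar>x a\<bar>) * (\<Prod>i\<in>A. 1 + \<bar>x i\<bar>)"
    by (intro mult_left_mono insert.IH) simp
  finally show ?case using insert.hyps by simp
qed simp

text \<open>An elementary form of \<open>\<Prod>(1 + x\<^sub>i) \<le> 1 / (1 - \<Sum>x\<^sub>i)\<close>.\<close>

lemma prod_one_plus_le:
  fixes x :: "'i \<Rightarrow> real"
  assumes "finite A" "\<And>i. i \<in> A \<Longrightarrow> 0 \<le> x i" "sum x A \<le> 1"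
  shows "(\<Prod>i\<in>A. 1 + x i) * (1 - sum x A) \<le> 1"
  using assms
proof (induction A rule: finite_induct)
  case (insert a A)
  have nn: "0 \<le> sum x A" "0 \<le> x a" using insert.prems by (auto intro: sum_nonneg)
  have "sum x A \<le> 1" using insert.prems(2) insert.hyps nn by simp
  then have le: "(\<Prod>i\<in>A. 1 + x i) * (1 - sum x A) \<le> 1" using insert.IH insert.prems(1) by simp
  have "0 \<le> (\<Prod>i\<in>A. 1 + x i)" using insert.prems by (intro prod_nonneg) auto
  moreover have "(1 + x a) * (1 - (x a + sum x A)) \<le> 1 - sum x A"
    using nn by (simp add: algebra_simps)
  ultimately have "(\<Prod>i\<in>A. 1 + x i) * ((1 + x a) * (1 - (x a + sum x A))) \<le>
      (\<Prod>i\<in>A. 1 + x i) * (1 - sum x A)" by (intro mult_left_mono)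
  then show ?case using insert.hyps le by (simp add: mult_ac)
qed simp

text \<open>A monic integer polynomial with distinct real roots greater than \<open>1\<close>, indexed by a finite set. The
  solutions of the associated linear recurrence are the sequences \<open>x g\<close>.\<close>

locale integer_recurrence =
  fixes A :: "'i set" and d :: nat and \<alpha> :: "'i \<Rightarrow> real" and P :: "int poly"
  assumes finite_A [simp]: "finite A" and card_A [simp]: "card A = d" and d_pos: "d > 0"
    and root_gt_1: "\<And>i. i \<in> A \<Longrightarrow> \<alpha> i > 1"
    and inj: "inj_on \<alpha> A"
    and factors: "map_poly real_of_int P = (\<Prod>i\<in>A. [:- \<alpha> i, 1:])"
begin

abbreviation R :: "nat \<Rightarrow> real" where
  "R k \<equiv> lagrange_power_sum A \<alpha> k"

abbreviation h :: "nat \<Rightarrow> real" where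
  "h m \<equiv> complete_homogeneous A (\<lambda>i. inverse (\<alpha> i)) m"

abbreviation x :: "('i \<Rightarrow> real) \<Rightarrow> nat \<Rightarrow> real" where
  "x g n \<equiv> (\<Sum>i\<in>A. g i * \<alpha> i ^ n)"

abbreviation a :: "nat \<Rightarrow> real" where
  "a j \<equiv> real_of_int (coeff P j)"

text \<open>The coefficients of the partial fraction expansion of the generating function of \<open>h\<close>.\<close>

definition dual_weight :: "'i \<Rightarrow> real" where
  "dual_weight i = (\<Prod>j\<in>A - {i}. inverse (\<alpha> i) / (inverse (\<alpha> i) - inverse (\<alpha> j)))"

lemma coeff_real: "coeff (\<Prod>i\<in>A. [:- \<alpha> i, 1:]) j = a j"
  by (simp add: factors [symmetric] coeff_map_poly)

lemma degree_factors: "degree (\<Prod>i\<in>A. [:- \<alpha> i, 1:]) = d"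
  by (subst degree_prod_eq_sum_degree) auto

lemma a_top: "a d = 1"
proof -
  have "lead_coeff (\<Prod>i\<in>A. [:- \<alpha> i, 1:]) = 1" by (simp add: lead_coeff_prod)
  then show ?thesis by (simp add: degree_factors coeff_real)
qed

lemma a_0: "a 0 = (-1) ^ d * (\<Prod>i\<in>A. \<alpha> i)"
proof -
  have "a 0 = poly (\<Prod>i\<in>A. [:- \<alpha> i, 1:]) 0" by (simp only: poly_0_coeff_0 coeff_real)
  also have "\<dots> = (\<Prod>i\<in>A. - \<alpha> i)" by (simp add: poly_prod)
  also have "\<dots> = (-1) ^ d * (\<Prod>i\<in>A. \<alpha> i)" by (simp add: prod_uminus)
  finally show ?thesis .
qed

lemma prod_roots_pos: "(\<Prod>i\<in>A. \<alpha> i) > 0"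
  using root_gt_1 by (intro prod_pos) force

lemma a_0_nonzero: "a 0 \<noteq> 0"
  unfolding a_0 using prod_roots_pos by (metis less_irrefl mult_eq_0_iff neg_equal_0_iff_equal one_neq_zero power_not_zero)

lemma root_equation:
  assumes "i \<in> A"
  shows "(\<Sum>j\<le>d. a j * \<alpha> i ^ j) = 0"
proof -
  have "poly (\<Prod>i\<in>A. [:- \<alpha> i, 1:]) (\<alpha> i) = 0" using assms by (auto simp: poly_prod)
  then show ?thesis by (simp add: poly_altdef degree_factors coeff_real)
qed

lemma R_low: "k < d \<Longrightarrow> R k = (if k = d - 1 then 1 else 0)"
  using lagrange_power_sum_low [of "A" \<alpha> "d - 1" k] inj d_pos by simp

text \<open>\<open>R\<close> satisfies the recurrence, which is monic, and has the initial values \<open>0, \<dots>, 0, 1\<close>.\<close>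

lemma R_Ints: "R k \<in> \<int>"
proof (induction k rule: less_induct)
  case (less k)
  show ?case
  proof (cases "k < d")
    case True then show ?thesis by (simp add: R_low)
  next
    case False
    then obtain n where k: "k = d + n" by (metis le_Suc_ex not_less)
    have "(\<Sum>j\<le>d. a j * R (j + n)) =
        (\<Sum>i\<in>A. (\<Sum>j\<le>d. a j * \<alpha> i ^ j) * (\<alpha> i ^ n / (\<Prod>j\<in>A - {i}. \<alpha> i - \<alpha> j)))"
      unfolding lagrange_power_sum_def sum_distrib_left sum_distrib_right
      by (subst sum.swap) (simp add: power_add mult_ac)
    also have "\<dots> = 0" by (simp add: root_equation)
    finally have "R (d + n) = - (\<Sum>j<d. a j * R (j + n))"
      using a_top by (simp add: lessThan_Suc_atMost [symmetric])
    also have "\<dots> \<in> \<int>" using less k by (intro Ints_minus Ints_sum Ints_mult) auto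
    finally show ?thesis by (simp add: k)
  qed
qed

lemma h_eq: "h m = (\<Sum>i\<in>A. dual_weight i * inverse (\<alpha> i) ^ m)"
  by (simp add: complete_homogeneous_eq_sum dual_weight_def)

text \<open>Continued to negative indices, the sequence \<open>h\<close> takes values in the integer multiples of the constant
  term. This is what makes the part of the solution that comes from the past an integer.\<close>

lemma dual_weight_power_sum:
  "(\<Sum>i\<in>A. dual_weight i * \<alpha> i ^ Suc k) = - a 0 * R k"
proof -
  have "dual_weight i * \<alpha> i ^ Suc k = - a 0 * (\<alpha> i ^ k / (\<Prod>j\<in>A - {i}. \<alpha> i - \<alpha> j))"
    if i: "i \<in> A" for i
  proof -
    have "inverse (\<alpha> i) / (inverse (\<alpha> i) - inverse (\<alpha> j)) = - \<alpha> j / (\<alpha> i - \<alpha> j)"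
      if "j \<in> A - {i}" for j
    proof -
      have "\<alpha> i > 1" "\<alpha> j > 1" "\<alpha> i \<noteq> \<alpha> j"
        using root_gt_1 [OF i] root_gt_1 [of j] inj_onD [OF inj, of i j] i that by auto
      then show ?thesis by (simp add: divide_simps) (simp add: algebra_simps)
    qed
    then have "dual_weight i = (\<Prod>j\<in>A - {i}. - \<alpha> j / (\<alpha> i - \<alpha> j))"
      unfolding dual_weight_def by (intro prod.cong refl)
    then have "dual_weight i = (\<Prod>j\<in>A - {i}. - \<alpha> j) / (\<Prod>j\<in>A - {i}. \<alpha> i - \<alpha> j)"
      by (simp only: prod_dividef)
    then have "dual_weight i * \<alpha> i ^ Suc k = - (- \<alpha> i * (\<Prod>j\<in>A - {i}. - \<alpha> j)) *
        (\<alpha> i ^ k / (\<Prod>j\<in>A - {i}. \<alpha> i - \<alpha> j))"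
      by simp
    also have "- \<alpha> i * (\<Prod>j\<in>A - {i}. - \<alpha> j) = a 0"
      using prod.remove [of "A" i "\<lambda>j. - \<alpha> j"] i by (simp add: a_0 prod_uminus)
    finally show ?thesis .
  qed
  then show ?thesis by (simp add: lagrange_power_sum_def sum_distrib_left)
qed

lemma power_inverse_summable:
  assumes "i \<in> A" "\<And>m. \<bar>s m\<bar> \<le> B"
  shows "summable (\<lambda>m. inverse (\<alpha> i) ^ m * s m)"
proof (rule summable_comparison_test' [OF summable_mult [of "\<lambda>m. inverse (\<alpha> i) ^ m" B], of 0])
  have "\<alpha> i > 1" by (rule root_gt_1 [OF assms(1)])
  then show "summable (\<lambda>m. inverse (\<alpha> i) ^ m)"
    by (intro summable_geometric) (simp add: inverse_less_1_iff)
  show "norm (inverse (\<alpha> i) ^ m * s m) \<le> B * inverse (\<alpha> i) ^ m" for m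
    using assms(2) [of m] \<open>\<alpha> i > 1\<close> by (simp add: abs_mult mult.commute [of B] mult_left_mono)
qed

lemma weighted_sum_split:
  assumes "\<And>m. \<bar>s m\<bar> \<le> B"
  shows "(\<Sum>m. h m * s m) = (\<Sum>i\<in>A. dual_weight i * (\<Sum>m. inverse (\<alpha> i) ^ m * s m))"
proof -
  have "(\<Sum>i\<in>A. dual_weight i * (\<Sum>m. inverse (\<alpha> i) ^ m * s m)) =
      (\<Sum>i\<in>A. \<Sum>m. dual_weight i * (inverse (\<alpha> i) ^ m * s m))"
    by (intro sum.cong refl suminf_mult [symmetric] power_inverse_summable [OF _ assms])
  also have "\<dots> = (\<Sum>m. \<Sum>i\<in>A. dual_weight i * (inverse (\<alpha> i) ^ m * s m))"
    by (intro suminf_sum [symmetric] summable_mult power_inverse_summable [OF _ assms])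
  finally show ?thesis by (simp add: h_eq sum_distrib_right mult.assoc)
qed

text \<open>The coefficient \<open>g\<^sub>i\<close> is, up to a factor, the power series of \<open>s\<close> at the reciprocal root. Multiplying
  it by \<open>\<alpha>\<^sub>i\<^sup>n\<close> splits the series at \<open>n\<close>: the future terms sum to \<open>\<Sum>\<^sub>m h\<^sub>m s\<^sub>n\<^sub>+\<^sub>m\<close>, and the past
  terms to an integer multiple of the constant term.\<close>

theorem integer_sequence_realized:
  assumes int: "\<And>n. s n \<in> \<int>" and bound: "\<And>n. \<bar>s n\<bar> \<le> B"
  shows "\<exists>g. \<forall>n. x g n - (\<Sum>m. h m * s (n + m)) / a 0 \<in> \<int>"
proof -
  define Y where "Y i n = (\<Sum>m. inverse (\<alpha> i) ^ m * s (n + m))" for i n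
  define g where "g i = dual_weight i * Y i 0 / a 0" for i
  have Y: "Y i 0 * \<alpha> i ^ n = Y i n + (\<Sum>m<n. s m * \<alpha> i ^ (n - m))" if i: "i \<in> A" for i n
  proof (induction n)
    case (Suc n)
    have nz: "\<alpha> i \<noteq> 0" using root_gt_1 [OF i] by simp
    have "Y i n = s n + (\<Sum>m. inverse (\<alpha> i) ^ Suc m * s (n + Suc m))"
      unfolding Y_def using suminf_split_head [OF power_inverse_summable [OF i bound], of "\<lambda>m. n + m"]
      by simp
    also have "(\<Sum>m. inverse (\<alpha> i) ^ Suc m * s (n + Suc m)) = inverse (\<alpha> i) * Y i (Suc n)"
      unfolding Y_def
      by (subst suminf_mult [OF power_inverse_summable [OF i bound], symmetric]) (simp add: mult.assoc)
    finally have "\<alpha> i * Y i n = \<alpha> i * s n + Y i (Suc n)" using nz by (simp add: algebra_simps)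
    moreover have "(\<Sum>m<n. s m * \<alpha> i ^ (Suc n - m)) = \<alpha> i * (\<Sum>m<n. s m * \<alpha> i ^ (n - m))"
      by (simp add: sum_distrib_left Suc_diff_le mult_ac)
    moreover have "Y i 0 * \<alpha> i ^ Suc n = \<alpha> i * (Y i 0 * \<alpha> i ^ n)" by simp
    ultimately show ?case using Suc by (simp only: sum.lessThan_Suc distrib_left) simp
  qed simp
  have "x g n - (\<Sum>m. h m * s (n + m)) / a 0 \<in> \<int>" for n
  proof -
    have "a 0 * x g n = (\<Sum>i\<in>A. dual_weight i * (Y i 0 * \<alpha> i ^ n))"
      using a_0_nonzero by (simp add: g_def sum_distrib_left mult_ac)
    also have "\<dots> = (\<Sum>i\<in>A. dual_weight i * Y i n) +
        (\<Sum>i\<in>A. dual_weight i * (\<Sum>m<n. s m * \<alpha> i ^ (n - m)))"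
      by (simp add: Y distrib_left sum.distrib)
    also have "(\<Sum>i\<in>A. dual_weight i * Y i n) = (\<Sum>m. h m * s (n + m))"
      unfolding Y_def by (rule weighted_sum_split [symmetric]) (rule bound)
    also have "(\<Sum>i\<in>A. dual_weight i * (\<Sum>m<n. s m * \<alpha> i ^ (n - m))) =
        (\<Sum>m<n. s m * (\<Sum>i\<in>A. dual_weight i * \<alpha> i ^ Suc (n - Suc m)))"
      unfolding sum_distrib_left by (subst sum.swap) (simp add: Suc_diff_Suc mult_ac del: power_Suc)
    also have "\<dots> = - a 0 * (\<Sum>m<n. s m * R (n - Suc m))"
      by (simp only: dual_weight_power_sum sum_distrib_left mult_ac)
    finally have "a 0 * (x g n - (\<Sum>m. h m * s (n + m)) / a 0) =
        a 0 * - (\<Sum>m<n. s m * R (n - Suc m))"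
      using a_0_nonzero by (simp add: algebra_simps)
    then have "x g n - (\<Sum>m. h m * s (n + m)) / a 0 = - (\<Sum>m<n. s m * R (n - Suc m))"
      by (rule mult_left_cancel [OF a_0_nonzero, THEN iffD1])
    also have "\<dots> \<in> \<int>" by (intro Ints_minus Ints_sum Ints_mult int R_Ints)
    finally show ?thesis .
  qed
  then show ?thesis by blast
qed

text \<open>For a single root, \<open>Y\<^sub>i(n) = \<Sum>\<^sub>m \<alpha>\<^sub>i\<^sup>-\<^sup>m e\<^sub>n\<^sub>+\<^sub>m\<close> satisfies \<open>Y\<^sub>i(n + 1) = \<alpha>\<^sub>i (Y\<^sub>i(n) - e\<^sub>n)\<close>; applying
  the recurrence operator to \<open>Y\<^sub>i\<close> therefore leaves only finitely many terms, and after summation over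
  the roots the initial values of \<open>R\<close> cancel all of them but one.\<close>

lemma bounded_inversion:
  assumes bound: "\<And>n. \<bar>e n\<bar> \<le> B"
  shows "(\<Sum>m. h m * (\<Sum>j\<le>d. a j * e (n + m + j))) = a 0 * e n"
proof -
  define Y where "Y i n = (\<Sum>m. inverse (\<alpha> i) ^ m * e (n + m))" for i n
  have Y: "Y i (n + j) = \<alpha> i ^ j * Y i n - (\<Sum>l<j. \<alpha> i ^ (j - l) * e (n + l))"
    if i: "i \<in> A" for i n j
  proof (induction j)
    case (Suc j)
    have nz: "\<alpha> i \<noteq> 0" using root_gt_1 [OF i] by simp
    have "Y i (n + j) = e (n + j) + (\<Sum>m. inverse (\<alpha> i) ^ Suc m * e (n + j + Suc m))"
      unfolding Y_def using suminf_split_head [OF power_inverse_summable [OF i bound], of "\<lambda>m. n + j + m"]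
      by simp
    also have "(\<Sum>m. inverse (\<alpha> i) ^ Suc m * e (n + j + Suc m)) = inverse (\<alpha> i) * Y i (n + Suc j)"
      unfolding Y_def
      by (subst suminf_mult [OF power_inverse_summable [OF i bound], symmetric]) (simp add: mult.assoc)
    finally have "Y i (n + Suc j) = \<alpha> i * Y i (n + j) - \<alpha> i * e (n + j)"
      using nz by (simp add: algebra_simps)
    also have "\<dots> = \<alpha> i ^ Suc j * Y i n - (\<alpha> i * (\<Sum>l<j. \<alpha> i ^ (j - l) * e (n + l)) + \<alpha> i * e (n + j))"
      unfolding Suc.IH by (simp add: right_diff_distrib)
    also have "\<alpha> i * (\<Sum>l<j. \<alpha> i ^ (j - l) * e (n + l)) = (\<Sum>l<j. \<alpha> i ^ (Suc j - l) * e (n + l))"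
      by (simp add: sum_distrib_left Suc_diff_le mult_ac)
    finally show ?case by simp
  qed simp
  have tail: "(\<Sum>m. inverse (\<alpha> i) ^ m * (\<Sum>j\<le>d. a j * e (n + m + j))) =
      - (\<Sum>j\<le>d. a j * (\<Sum>l<j. \<alpha> i ^ (j - l) * e (n + l)))" if i: "i \<in> A" for i
  proof -
    have "(\<Sum>m. inverse (\<alpha> i) ^ m * (\<Sum>j\<le>d. a j * e (n + m + j))) =
        (\<Sum>m. \<Sum>j\<le>d. a j * (inverse (\<alpha> i) ^ m * e (n + j + m)))"
      by (simp add: sum_distrib_left mult_ac add_ac)
    also have "\<dots> = (\<Sum>j\<le>d. a j * Y i (n + j))"
      unfolding Y_def
      by (subst suminf_sum)
        (auto intro!: summable_mult power_inverse_summable [OF i bound] sum.cong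
          suminf_mult power_inverse_summable [OF i bound])
    also have "\<dots> = (\<Sum>j\<le>d. a j * \<alpha> i ^ j) * Y i n -
        (\<Sum>j\<le>d. a j * (\<Sum>l<j. \<alpha> i ^ (j - l) * e (n + l)))"
      by (simp add: Y [OF i] sum_distrib_right right_diff_distrib sum_subtractf mult.assoc)
    finally show ?thesis by (simp add: root_equation [OF i])
  qed
  have "\<bar>\<Sum>j\<le>d. a j * e (n + m + j)\<bar> \<le> (\<Sum>j\<le>d. \<bar>a j\<bar> * B)" for m
    by (rule order.trans [OF sum_abs]) (simp add: abs_mult bound mult_left_mono sum_mono)
  then have "(\<Sum>m. h m * (\<Sum>j\<le>d. a j * e (n + m + j))) =
      (\<Sum>i\<in>A. dual_weight i * - (\<Sum>j\<le>d. a j * (\<Sum>l<j. \<alpha> i ^ (j - l) * e (n + l))))"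
    by (subst weighted_sum_split) (simp_all add: tail)
  also have "\<dots> = - (\<Sum>i\<in>A. \<Sum>j\<le>d. \<Sum>l<j. a j * e (n + l) * (dual_weight i * \<alpha> i ^ (j - l)))"
    by (simp add: sum_distrib_left sum_negf mult_ac)
  also have "\<dots> = - (\<Sum>j\<le>d. \<Sum>l<j. \<Sum>i\<in>A. a j * e (n + l) * (dual_weight i * \<alpha> i ^ (j - l)))"
    by (subst sum.swap) (simp only: sum.swap [of _ _ "A"])
  also have "\<dots> = (\<Sum>j\<le>d. \<Sum>l<j. a j * e (n + l) * (a 0 * R (j - Suc l)))"
  proof -
    have "(\<Sum>i\<in>A. a j * e (n + l) * (dual_weight i * \<alpha> i ^ (j - l))) =
        - (a j * e (n + l) * (a 0 * R (j - Suc l)))" if "l < j" for j l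
      using dual_weight_power_sum [of "j - Suc l"] that
      by (simp add: sum_distrib_left [symmetric] Suc_diff_Suc del: power_Suc)
    then show ?thesis by (simp add: sum_negf)
  qed
  also have "\<dots> = (\<Sum>j\<le>d. if j = d then a 0 * e n else 0)"
  proof (intro sum.cong refl)
    fix j assume "j \<in> {..d}"
    then have R: "R (j - Suc l) = (if j = d \<and> l = 0 then 1 else 0)" if "l < j" for l
      using that R_low [of "j - Suc l"] by auto
    have "(\<Sum>l<j. a j * e (n + l) * (a 0 * R (j - Suc l))) =
        (\<Sum>l<j. if l = 0 then (if j = d then a 0 * e n else 0) else 0)"
      by (intro sum.cong refl) (auto simp: R a_top)
    then show "(\<Sum>l<j. a j * e (n + l) * (a 0 * R (j - Suc l))) = (if j = d then a 0 * e n else 0)"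
      using d_pos by simp
  qed
  finally show ?thesis by simp
qed

text \<open>The sequence \<open>s\<close> is obtained by applying the recurrence operator to the errors; it is an integer
  sequence because the operator annihilates \<open>x g\<close> and maps \<open>u\<close> to integers.\<close>

theorem integer_sequence_of_errors:
  obtains u s where "\<And>n. u n \<in> \<int>" "\<And>n. s n \<in> \<int>" "\<And>n. \<bar>s n\<bar> \<le> (\<Sum>j\<le>d. \<bar>a j\<bar>)"
    and "\<And>n. \<bar>x g n - u n\<bar> \<le> 1 / 2"
    and "\<And>n. (\<Sum>m. h m * s (n + m)) = a 0 * (x g n - u n)"
    and "\<And>n. \<bar>s n\<bar> \<le> (\<Sum>j\<le>d. \<bar>a j\<bar> * \<bar>x g (n + j) - u (n + j)\<bar>)"
proof -
  define u where "u n = real_of_int (round (x g n))" for n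
  define e where "e n = x g n - u n" for n
  define s where "s n = (\<Sum>j\<le>d. a j * e (n + j))" for n
  have half: "\<bar>e n\<bar> \<le> 1 / 2" for n
    using of_int_round_abs_le [of "x g n"] by (simp add: e_def u_def abs_minus_commute)
  have "(\<Sum>j\<le>d. a j * x g (n + j)) = 0" for n
  proof -
    have "(\<Sum>j\<le>d. a j * x g (n + j)) =
        (\<Sum>i\<in>A. g i * \<alpha> i ^ n * (\<Sum>j\<le>d. a j * \<alpha> i ^ j))"
      unfolding sum_distrib_left by (subst sum.swap) (simp add: power_add mult_ac)
    also have "\<dots> = 0" by (simp add: root_equation)
    finally show ?thesis .
  qed
  then have s_eq: "s n = - (\<Sum>j\<le>d. a j * u (n + j))" for n
    by (simp add: s_def e_def right_diff_distrib sum_subtractf)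
  have small: "\<bar>s n\<bar> \<le> (\<Sum>j\<le>d. \<bar>a j\<bar> * \<bar>e (n + j)\<bar>)" for n
    unfolding s_def by (rule order.trans [OF sum_abs]) (simp add: abs_mult)
  show ?thesis
  proof (rule that [of u s])
    show "u n \<in> \<int>" for n by (simp add: u_def)
    show "s n \<in> \<int>" for n unfolding s_eq by (intro Ints_minus Ints_sum Ints_mult) (auto simp: u_def)
    show "\<bar>s n\<bar> \<le> (\<Sum>j\<le>d. \<bar>a j\<bar>)" for n
    proof (rule order.trans [OF small], rule sum_mono)
      show "\<bar>a j\<bar> * \<bar>e (n + j)\<bar> \<le> \<bar>a j\<bar>" for j
        using half [of "n + j"] by (intro mult_left_le) auto
    qed
    show "\<bar>x g n - u n\<bar> \<le> 1 / 2" for n using half [of n] by (simp add: e_def)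
    show "(\<Sum>m. h m * s (n + m)) = a 0 * (x g n - u n)" for n
      using bounded_inversion [where e = e and n = n, OF half] by (simp add: s_def e_def)
    show "\<bar>s n\<bar> \<le> (\<Sum>j\<le>d. \<bar>a j\<bar> * \<bar>x g (n + j) - u (n + j)\<bar>)" for n
      using small [of n] by (simp add: e_def)
  qed
qed

lemma sum_abs_a_le: "(\<Sum>j\<le>d. \<bar>a j\<bar>) \<le> \<bar>a 0\<bar> * (\<Prod>i\<in>A. 1 + inverse (\<alpha> i))"
proof -
  have "(\<Sum>j\<le>d. \<bar>a j\<bar>) \<le> (\<Prod>i\<in>A. 1 + \<bar>\<alpha> i\<bar>)"
    using sum_abs_coeff_prod_linear [of "A" \<alpha>] by (simp add: coeff_real)
  also have "\<dots> = (\<Prod>i\<in>A. \<alpha> i * (1 + inverse (\<alpha> i)))"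
    using root_gt_1 by (intro prod.cong refl) (force simp: distrib_left)
  also have "\<dots> = \<bar>a 0\<bar> * (\<Prod>i\<in>A. 1 + inverse (\<alpha> i))"
    using prod_roots_pos by (simp add: a_0 abs_mult prod.distrib)
  finally show ?thesis .
qed

end

section \<open>The spectrum below the Thue-Morse value\<close>

lemma limsup_recurrent_max:
  fixes f :: "nat \<Rightarrow> real"
  assumes "\<And>n. f n \<le> c" "\<And>q. f (p * q) = c" "p > 0"
  shows "limsup (\<lambda>n. ereal (f n)) = ereal c"
proof (rule antisym)
  show "limsup (\<lambda>n. ereal (f n)) \<le> ereal c"
    by (intro Limsup_bounded) (simp add: assms)
  have "limsup ((\<lambda>n. ereal (f n)) \<circ> (\<lambda>q. p * q)) \<le> limsup (\<lambda>n. ereal (f n))"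
    using \<open>p > 0\<close> by (intro limsup_subseq_mono) (simp add: strict_mono_def)
  then show "ereal c \<le> limsup (\<lambda>n. ereal (f n))"
    by (simp add: o_def assms Limsup_const)
qed

text \<open>Below any \<open>m < c\<close> the set has only finitely many elements: possibly \<open>0\<close>, and finitely many of the
  \<open>v k\<close>.\<close>

lemma least_limit_point_of_increasing_values:
  fixes v :: "nat \<Rightarrow> real"
  assumes v: "v \<longlonglongrightarrow> c" "\<And>k. 0 < v k" "\<And>k. v k < c"
    and S: "S \<inter> {0<..<c} = range v" "\<And>y. y \<in> S \<Longrightarrow> 0 \<le> y"
  shows "c islimpt S" and "y islimpt S \<Longrightarrow> c \<le> y"
proof -
  have vS: "v k \<in> S" for k using S(1) by blast
  show "c islimpt S" unfolding islimpt_sequential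
    using v vS by (intro exI [of _ v]) (auto simp: less_imp_neq)
  assume y: "y islimpt S"
  show "c \<le> y"
  proof (rule ccontr)
    assume "\<not> c \<le> y"
    then obtain m where m: "y < m" "m < c" using dense [of y c] by auto
    obtain K where K: "\<And>k. k \<ge> K \<Longrightarrow> m < v k"
      using order_tendstoD(1) [OF v(1) m(2)] by (auto simp: eventually_sequentially)
    have "S \<inter> {..<m} \<subseteq> insert 0 (v ` {..<K})"
    proof
      fix z assume z: "z \<in> S \<inter> {..<m}"
      show "z \<in> insert 0 (v ` {..<K})"
      proof (cases "z = 0")
        case False
        then have "z \<in> S \<inter> {0<..<c}" using z S(2) [of z] m by auto
        then obtain k where k: "z = v k" using S(1) by auto
        then have "k < K" using z K [of k] by (force simp: not_less [symmetric])
        then show ?thesis using k by auto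
      qed simp
    qed
    then have "finite (S \<inter> {..<m})" by (rule finite_subset) simp
    then have "finite ({..<m} \<inter> S)" by (simp only: Int_commute)
    moreover have "infinite ({..<m} \<inter> S)"
      using y m(1) unfolding islimpt_eq_acc_point by (metis lessThan_iff open_lessThan)
    ultimately show False by blast
  qed
qed

locale large_root_recurrence = integer_recurrence +
  assumes sum_reciprocals: "(\<Sum>i\<in>A. inverse (\<alpha> i)) \<le> 1 / 2"
begin

lemma A_nonempty: "A \<noteq> {}"
  using card_A d_pos by (metis card.empty less_irrefl)

lemma inverse_pos: "i \<in> A \<Longrightarrow> 0 < inverse (\<alpha> i)"
  using root_gt_1 [of i] by simp

sublocale halving_weights h
proof
  have inj': "inj_on (\<lambda>i. inverse (\<alpha> i)) A"
    using inj by (auto simp: inj_on_def)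
  show "h 0 = 1" by (rule complete_homogeneous_0 [OF finite_A A_nonempty inj'])
  note growth = complete_homogeneous_growth [OF finite_A A_nonempty inj' inverse_pos]
  show pos: "0 < h m" for m using growth by blast
  show "2 * h (Suc m) \<le> h m" for m
  proof -
    have "h (Suc m) \<le> (\<Sum>i\<in>A. inverse (\<alpha> i)) * h m" using growth by blast
    also have "\<dots> \<le> 1 / 2 * h m"
      using pos [of m] sum_reciprocals by (intro mult_right_mono) auto
    finally show ?thesis by simp
  qed
qed

text \<open>Ensures that the errors constructed from sign sequences are at most \<open>1 / 2\<close>, so that they are
  distances to the nearest integer.\<close>

lemma constant_term_ge_2: "2 \<le> \<bar>a 0\<bar>"
proof -
  have "2 \<le> \<alpha> i" if "i \<in> A" for i
  proof -
    have "inverse (\<alpha> i) \<le> (\<Sum>i\<in>A. inverse (\<alpha> i))"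
      using that inverse_pos by (intro member_le_sum) (auto intro: less_imp_le)
    then have "inverse (\<alpha> i) \<le> 1 / 2" using sum_reciprocals by linarith
    then show ?thesis using root_gt_1 [OF that] by (simp add: field_simps)
  qed
  then have "(\<Prod>i\<in>A. 2) \<le> (\<Prod>i\<in>A. \<alpha> i)" by (intro prod_mono) simp
  moreover have "(2::real) ^ 1 \<le> 2 ^ d" using d_pos by (intro power_increasing) auto
  ultimately show ?thesis using prod_roots_pos by (simp add: a_0 abs_mult)
qed

definition limsup_values :: "real set" where
  "limsup_values = {l. \<exists>g. ereal l = limsup (\<lambda>n. ereal (infdist (x g n) \<int>))}"

lemma limsup_values_nonneg: "l \<in> limsup_values \<Longrightarrow> 0 \<le> l"
proof -
  assume "l \<in> limsup_values"
  then obtain g where "ereal l = limsup (\<lambda>n. ereal (infdist (x g n) \<int>))"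
    by (auto simp: limsup_values_def)
  also have "0 \<le> \<dots>"
    by (intro le_Limsup) (auto simp: infdist_nonneg)
  finally show ?thesis by simp
qed

lemma periodic_limsup:
  "limsup (\<lambda>n. ereal (code_val (signed_tail (periodic_tm k) n) / \<bar>a 0\<bar>)) =
    ereal (code_val (periodic_tm k) / \<bar>a 0\<bar>)"
proof (rule limsup_recurrent_max)
  show "code_val (signed_tail (periodic_tm k) n) / \<bar>a 0\<bar> \<le> code_val (periodic_tm k) / \<bar>a 0\<bar>" for n
    by (rule divide_right_mono [OF code_val_periodic_tail_le]) simp
  show "code_val (signed_tail (periodic_tm k) (2 ^ Suc k * q)) / \<bar>a 0\<bar> = code_val (periodic_tm k) / \<bar>a 0\<bar>" for q
    by (simp only: signed_tail_periodic_tm)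
qed simp

lemma periodic_value_attained: "code_val (periodic_tm k) / \<bar>a 0\<bar> \<in> limsup_values"
proof -
  note t = sign_seq_periodic_tm [of k]
  define s where "s n = (periodic_tm k n - periodic_tm k (Suc n)) / 2" for n
  have s: "s n \<in> \<int>" "\<bar>s n\<bar> \<le> 1" for n
    using sign_seqD [OF t, of n] sign_seqD [OF t, of "Suc n"] by (auto simp: s_def)
  obtain g where g: "\<And>n. x g n - (\<Sum>m. h m * s (n + m)) / a 0 \<in> \<int>"
    using integer_sequence_realized [where s = s, OF s] by blast
  have "infdist (x g n) \<int> = code_val (signed_tail (periodic_tm k) n) / \<bar>a 0\<bar>" for n
  proof -
    let ?e = "(\<Sum>m. h m * s (n + m)) / a 0"
    have e: "\<bar>?e\<bar> = code_val (signed_tail (periodic_tm k) n) / \<bar>a 0\<bar>"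
      using weighted_tail_code [OF t, of s n] by (simp add: s_def weighted_tail_def)
    also have "\<dots> \<le> 1 / \<bar>a 0\<bar>"
      by (intro divide_right_mono code_val_bounds sign_seq_signed_tail signed_tail_0 t) simp
    also have "\<dots> \<le> 1 / 2" using constant_term_ge_2 by (intro divide_left_mono) auto
    finally show ?thesis using infdist_Ints_eq [OF g [of n], of ?e] e by simp
  qed
  then show ?thesis
    unfolding limsup_values_def mem_Collect_eq
    by (intro exI [of _ g]) (simp only: periodic_limsup)
qed

text \<open>The bound on the limsup holds with a margin for all large \<open>n\<close>. Applying the recurrence operator to
  errors of that size gives integers of modulus less than \<open>2\<close>; they are not eventually zero, because
  the limsup is positive.\<close>

lemma small_value_periodic:
  assumes l: "l \<in> limsup_values" "0 < l" "l < code_val thue_morse / \<bar>a 0\<bar>"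
  shows "\<exists>k. l = code_val (periodic_tm k) / \<bar>a 0\<bar>"
proof -
  have N: "\<bar>a 0\<bar> > 0" using a_0_nonzero by simp
  obtain g where g: "ereal l = limsup (\<lambda>n. ereal (infdist (x g n) \<int>))"
    using l(1) by (auto simp: limsup_values_def)
  obtain u s where u: "\<And>n. u n \<in> \<int>" and s_int: "\<And>n. s n \<in> \<int>"
    and s_bound: "\<And>n. \<bar>s n\<bar> \<le> (\<Sum>j\<le>d. \<bar>a j\<bar>)"
    and half: "\<And>n. \<bar>x g n - u n\<bar> \<le> 1 / 2"
    and tail: "\<And>n. (\<Sum>m. h m * s (n + m)) = a 0 * (x g n - u n)"
    and s_le: "\<And>n. \<bar>s n\<bar> \<le> (\<Sum>j\<le>d. \<bar>a j\<bar> * \<bar>x g (n + j) - u (n + j)\<bar>)"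
    by (rule integer_sequence_of_errors [of g]) blast
  define e where "e n = \<bar>x g n - u n\<bar>" for n
  have dist: "infdist (x g n) \<int> = e n" for n
    using infdist_Ints_eq [OF u [of n] half [of n]] by (simp add: e_def)
  have lim: "ereal l = limsup (\<lambda>n. ereal (e n))" using g by (simp add: dist)
  obtain c where c: "l < c" "c < code_val thue_morse / \<bar>a 0\<bar>" using dense [OF l(3)] by blast
  have "eventually (\<lambda>n. ereal (e n) < ereal c) sequentially"
    using c(1) by (intro Limsup_lessD) (simp flip: lim)
  then obtain n0 where n0: "\<And>n. n \<ge> n0 \<Longrightarrow> e n < c" by (auto simp: eventually_sequentially)
  define s' where "s' n = s (n0 + n)" for n
  define \<eta> where "\<eta> = code_val thue_morse - \<bar>a 0\<bar> * c"
  have \<eta>: "\<eta> > 0" using c(2) N by (simp add: \<eta>_def field_simps)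
  have tail': "\<bar>weighted_tail s' n\<bar> = \<bar>a 0\<bar> * e (n0 + n)" for n
    using tail [of "n0 + n"] by (simp add: weighted_tail_def s'_def e_def abs_mult add.assoc)
  \<comment> \<open>The sequence is shifted by \<open>n0\<close> so that the bounds hold at every position.\<close>
  have small: "\<bar>weighted_tail s' n\<bar> \<le> code_val thue_morse - \<eta>" for n
    using n0 [of "n0 + n"] N by (simp add: tail' \<eta>_def)
  have s': "s' n \<in> {-1, 0, 1}" for n
  proof -
    have "\<bar>s' n\<bar> \<le> (\<Sum>j\<le>d. \<bar>a j\<bar> * c)"
      unfolding s'_def
    proof (rule order.trans [OF s_le], rule sum_mono)
      show "\<bar>a j\<bar> * \<bar>x g (n0 + n + j) - u (n0 + n + j)\<bar> \<le> \<bar>a j\<bar> * c" for j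
        using n0 [of "n0 + n + j"] by (intro mult_left_mono) (auto simp: e_def)
    qed
    also have "\<dots> = (\<Sum>j\<le>d. \<bar>a j\<bar>) * c" by (simp add: sum_distrib_right)
    also have "\<dots> \<le> (\<bar>a 0\<bar> * (\<Prod>i\<in>A. 1 + inverse (\<alpha> i))) * c"
      using l c by (intro mult_right_mono sum_abs_a_le) auto
    also have "\<dots> \<le> (\<bar>a 0\<bar> * 2) * c"
    proof -
      let ?p = "\<Prod>i\<in>A. 1 + inverse (\<alpha> i)"
      have "?p * (1 - (\<Sum>i\<in>A. inverse (\<alpha> i))) \<le> 1"
        using sum_reciprocals inverse_pos by (intro prod_one_plus_le) (auto intro: less_imp_le)
      moreover have "0 \<le> ?p" using inverse_pos by (intro prod_nonneg) (force intro: add_nonneg_nonneg)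
      then have "?p * (1 / 2) \<le> ?p * (1 - (\<Sum>i\<in>A. inverse (\<alpha> i)))"
        using sum_reciprocals by (intro mult_left_mono) auto
      ultimately have "?p \<le> 2" by simp
      then show ?thesis using l c by (intro mult_right_mono mult_left_mono) auto
    qed
    also have "\<dots> < 2"
      using \<eta> code_val_bounds(2) [OF sign_seq_thue_morse] by (simp add: \<eta>_def)
    finally have "\<bar>s' n\<bar> < 2" .
    moreover obtain z :: int where "s' n = of_int z"
      using s_int unfolding s'_def by (auto elim: Ints_cases)
    ultimately have "z \<in> {-1, 0, 1}" by auto
    then show ?thesis using \<open>s' n = of_int z\<close> by auto
  qed
  have inf: "\<exists>n\<ge>N. s' n \<noteq> 0" for N
  proof (rule ccontr)
    assume "\<not> ?thesis"
    then have "s' (N + n + m) = 0" for n m by simp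
    then have "weighted_tail s' (N + n) = 0" for n by (simp add: weighted_tail_def)
    then have "e (n0 + (N + n)) = 0" for n using tail' [of "N + n"] N by simp
    then have zero: "e (n + (n0 + N)) = 0" for n by (metis add.assoc add.commute)
    have "limsup (\<lambda>n. ereal (e n)) = limsup (\<lambda>n. ereal (e (n + (n0 + N))))"
      by (rule limsup_shift_k [symmetric])
    then show False using lim l(2) by (simp add: zero Limsup_const)
  qed
  obtain k M where kM: "\<And>n. \<bar>weighted_tail s' (M + n)\<bar> = code_val (signed_tail (periodic_tm k) n)"
    using small_weighted_tails_periodic [OF s' inf \<eta> small] by blast
  have "e (n + (n0 + M)) = code_val (signed_tail (periodic_tm k) n) / \<bar>a 0\<bar>" for n
    using kM [of n] tail' [of "M + n"] N by (simp add: field_simps add_ac)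
  then have "ereal l = ereal (code_val (periodic_tm k) / \<bar>a 0\<bar>)"
    using limsup_shift_k [of "\<lambda>n. ereal (e n)" "n0 + M"] lim periodic_limsup [of k] by simp
  then show ?thesis by auto
qed

theorem limsup_values_below_thue_morse:
  "limsup_values \<inter> {0<..<code_val thue_morse / \<bar>a 0\<bar>} = range (\<lambda>k. code_val (periodic_tm k) / \<bar>a 0\<bar>)"
proof -
  have N: "\<bar>a 0\<bar> > 0" using a_0_nonzero by simp
  then have "code_val (periodic_tm k) / \<bar>a 0\<bar> \<in> {0<..<code_val thue_morse / \<bar>a 0\<bar>}" for k
    using code_val_periodic_pos [of k] code_val_periodic_less [of k] by (simp add: divide_strict_right_mono)
  then show ?thesis using small_value_periodic periodic_value_attained by fastforce
qed

theorem least_limit_point: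
  "code_val thue_morse / \<bar>a 0\<bar> islimpt limsup_values"
  "y islimpt limsup_values \<Longrightarrow> code_val thue_morse / \<bar>a 0\<bar> \<le> y"
proof -
  have N: "\<bar>a 0\<bar> > 0" using a_0_nonzero by simp
  have "(\<lambda>k. code_val (periodic_tm k) / \<bar>a 0\<bar>) \<longlonglongrightarrow> code_val thue_morse / \<bar>a 0\<bar>"
    using N by (intro tendsto_divide code_val_periodic_tendsto tendsto_const) simp
  moreover have "0 < code_val (periodic_tm k) / \<bar>a 0\<bar>"
    "code_val (periodic_tm k) / \<bar>a 0\<bar> < code_val thue_morse / \<bar>a 0\<bar>" for k
    using N code_val_periodic_pos [of k] code_val_periodic_less [of k]
    by (simp_all add: divide_strict_right_mono)
  ultimately show "code_val thue_morse / \<bar>a 0\<bar> islimpt limsup_values"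
    "y islimpt limsup_values \<Longrightarrow> code_val thue_morse / \<bar>a 0\<bar> \<le> y"
    using least_limit_point_of_increasing_values [OF _ _ _ limsup_values_below_thue_morse limsup_values_nonneg]
    by blast+
qed

end

lemma distinct_roots:
  assumes "rsquarefree (smult c (\<Prod>i\<in>A. [:- \<alpha> i, 1:]))" and "finite A"
  shows "inj_on \<alpha> A"
proof (rule inj_onI, rule ccontr)
  fix i j assume ij: "i \<in> A" "j \<in> A" "\<alpha> i = \<alpha> j" "i \<noteq> j"
  let ?p = "smult c (\<Prod>i\<in>A. [:- \<alpha> i, 1:])"
  have "(\<Prod>i\<in>A. [:- \<alpha> i, 1:]) = [:- \<alpha> i, 1:] * ([:- \<alpha> j, 1:] * (\<Prod>i\<in>A - {i} - {j}. [:- \<alpha> i, 1:]))"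
    using ij assms(2) by (subst prod.remove [of A i]) (auto simp: prod.remove [of "A - {i}" j])
  then have "[:- \<alpha> i, 1:] ^ 2 dvd ?p"
    using ij(3) by (intro dvd_smult) (simp only: power2_eq_square mult.assoc [symmetric] dvd_triv_left)
  then have "?p = 0 \<or> 2 \<le> order (\<alpha> i) ?p" by (simp only: order_divides)
  then show False using assms(1) unfolding rsquarefree_def by (elim conjE allE [of _ "\<alpha> i"]) auto
qed

lemma real_factorization:
  fixes \<alpha> :: "nat \<Rightarrow> real"
  assumes "lists_roots P (\<lambda>i. complex_of_real (\<alpha> i))" "lead_coeff P = 1"
  shows "map_poly real_of_int P = (\<Prod>i\<in>{1..degree P}. [:- \<alpha> i, 1:])"
proof -
  have "poly (map_poly real_of_int P) x = poly (\<Prod>i\<in>{1..degree P}. [:- \<alpha> i, 1:]) x" for x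
  proof -
    have "complex_of_real (poly (map_poly real_of_int P) x) = poly (map_poly complex_of_int P) (of_real x)"
      by (simp add: poly_altdef coeff_map_poly degree_map_poly)
    also have "\<dots> = complex_of_real (poly (\<Prod>i\<in>{1..degree P}. [:- \<alpha> i, 1:]) x)"
      using assms by (simp add: lists_roots_def poly_prod)
    finally show ?thesis by (simp only: of_real_eq_iff)
  qed
  then show ?thesis by (simp add: poly_eq_poly_eq_iff [symmetric] fun_eq_iff)
qed

theorem corollary1:
  fixes P :: "int poly" and d :: nat and \<alpha> :: "nat \<Rightarrow> real"
  assumes "admissible_poly P"
    and "d = degree P"
    and "lists_roots P (\<lambda>i. complex_of_real (\<alpha> i))"
    and "lead_coeff P = 1"
    and "\<forall>j\<in>{1..d}. \<alpha> j > 1"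
    and "(\<Sum>j\<in>{1..d}. inverse (\<alpha> j)) \<le> 1 / 2"
  defines "c \<equiv> E_multi d (\<lambda>j. inverse (\<alpha> j)) / \<bar>of_int (coeff P 0)\<bar>"
  shows "c islimpt spectrum d \<alpha> \<and> (\<forall>y. y islimpt spectrum d \<alpha> \<longrightarrow> c \<le> y) \<and>
    spectrum d \<alpha> \<inter> {0<..<c} =
      {E_multi_trunc k d (\<lambda>j. inverse (\<alpha> j)) / \<bar>of_int (coeff P 0)\<bar> | k. True}"
proof -
  have "rsquarefree (smult (complex_of_int (lead_coeff P))
      (\<Prod>i\<in>{1..d}. [:- complex_of_real (\<alpha> i), 1:]))"
    using assms(1-3) by (simp add: admissible_poly_def lists_roots_def)
  then have "inj_on (complex_of_real \<circ> \<alpha>) {1..d}"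
    unfolding o_def by (rule distinct_roots) simp
  then have inj: "inj_on \<alpha> {1..d}" by (rule inj_on_imageI2)
  have d: "d > 0" using assms(1,2) by (simp add: admissible_poly_def)
  interpret large_root_recurrence "{1..d}" d \<alpha> P
    using assms(5,6) d inj real_factorization [OF assms(3,4)] assms(2) by unfold_locales auto
  let ?X = "\<lambda>j. inverse (\<alpha> j)"
  have X: "0 < ?X i" "?X i < 1" if "i \<in> {1..d}" for i
    using root_gt_1 [OF that] by (simp_all add: inverse_less_1_iff)
  have E: "E_multi d ?X = code_val thue_morse"
    unfolding E_multi_def code_val_def
    by (intro sums_unique interp_sums E_sums X)
  have E_trunc: "E_multi_trunc k d ?X = code_val (periodic_tm k)" for k
    unfolding E_multi_trunc_def code_val_def
    by (intro sums_unique interp_sums E_trunc_sums X)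
  have spec: "spectrum d \<alpha> = limsup_values"
    unfolding spectrum_def limsup_values_def xseq_def ..
  have c: "c = code_val thue_morse / \<bar>real_of_int (coeff P 0)\<bar>"
    by (simp only: c_def E)
  show ?thesis
    unfolding c E_trunc spec
    by (intro conjI allI impI least_limit_point) (assumption | simp only: limsup_values_below_thue_morse full_SetCompr_eq simp_thms)+
qed

end
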